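(* Let $K$ be a finite set, $\phi\in L[K]$, $\lambda\in\mathcal S^\phi$ and $J=(J_1,\dots,J_\ell)\models K$. If $\lambda\neq\lambda_{J_1}\cup\cdots\cup\lambda_{J_\ell}$ then $\Delta_J(P^{(q)}_{(\phi,\lambda)})=0$. If $\lambda=\lambda_{J_1}\cup\cdots\cup\lambda_{J_\ell}$ then $$\Delta_J(P^{(q)}_{(\phi,\lambda)})=\sum_{\substack{\mu\in\mathcal S^\phi,\ \mu\supseteq\lambda\\ \mu=\mu_{J_1}\cup\cdots\cup\mu_{J_\ell}}}a^\lambda_{J,\mu}\,P^{(q)}_{(\phi|_{J_1},\mu_{J_1})}\otimes\cdots\otimes P^{(q)}_{(\phi|_{J_\ell},\mu_{J_\ell})},$$ where $$a^\lambda_{J,\mu}=\prod_{k=1}^\ell\ \prod_{i\frown j\in\mu_{J_k}\setminus\lambda}\Big(\frac{1}{q^{\mathrm{nst}^\lambda_{i\frown j}}}-\frac{1}{q^{\mathrm{nst}^{\mu_{J_k}}_{i\frown j}}}\Big).$$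
   Context: Fix a prime power $q$. For a finite set $K$, $L[K]$ is the set of linear orders on $K$; an order $\phi$ is identified with the word listing $K$ in increasing order ($i\prec_\phi j$: $i$ before $j$); $\phi|_J$ is the restriction to $J\subseteq K$. A set composition $(J_1,\dots,J_\ell)\models K$ is a sequence of nonempty disjoint sets with union $K$. For $\phi\in L[K]$, a set partition w.r.t. $\phi$ is a set $\lambda$ of arcs $i\frown j$ with $i\frown j\in\lambda\Rightarrow i\prec_\phi j$ and, for $i\frown l,j\frown k\in\lambda$, $i=j$ iff $k=l$; $\mathcal S^\phi$ is the set of these. $\lambda_J=\{i\frown j\in\lambda:i,j\in J\}$. For sets of arcs $\lambda,\mu$ on $K$, $\mathrm{nst}^\lambda_\mu=\#\{(i\frown l,j\frown k)\in\lambda\times\mu:i\prec_\phi j\prec_\phi k\prec_\phi l\}$ (all nestings computed in the order $\phi$), and $\mathrm{nst}^\lambda_{i\frown j}=\mathrm{nst}^\lambda_{\{i\frown j\}}$. $U^\phi$ is the group of invertible $\mathbb F_q$-matrices indexed by $K$ with $u_{ii}=1$, $u_{ij}=0$ unless $i=j$ or $i\prec_\phi j$; $u,v$ are in the same superclass if $v-1=ta(u-1)b^{-1}t^{-1}$ ($a,b\in U^\phi$, $t$ invertible diagonal); superclasses are indexed by $\mu\in\mathcal S^\phi$ (containing $1+\sum_{i\frown j\in\mu}e_{ij}$); $\kappa_{(\phi,\mu)}$ is the indicator of superclass $\mu$, $\mathrm{scf}^\phi$ their span. The Hopf monoid $\mathbf{scf}(U)$ has $\mathbf{scf}(U)[K]=\bigoplus_{\phi\in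 L[K]}\mathrm{scf}^\phi$, product by inflation along $U^{\phi\tau}\to U^\phi\times U^\tau$ (diagonal blocks), coproduct $\Delta_{I,J}$ by restriction to the block-diagonal subgroup $U^{\phi|_I}\times U^{\phi|_J}$; concretely $\Delta_{I,J}(\kappa_{(\phi,\mu)})=\kappa_{(\phi|_I,\mu_I)}\otimes\kappa_{(\phi|_J,\mu_J)}$ if $\mu=\mu_I\cup\mu_J$, else $0$. For $J\models K$, $\Delta_J$ is the iterated coproduct: $\Delta_{(K)}=\mathrm{id}$, $\Delta_J=(\Delta_{J_1,J_2}\otimes\mathrm{id}\otimes\cdots)\circ\cdots\circ\Delta_{K\setminus J_\ell,J_\ell}$. Define $P^{(q)}_{(\phi,\lambda)}=\sum_{\mu\in\mathcal S^\phi,\ \mu\supseteq\lambda}q^{-\mathrm{nst}^\lambda_{\mu\setminus\lambda}}\kappa_{(\phi,\mu)}$. *)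

theory Defs
  imports Complex_Main "HOL-Library.Cardinality" "HOL-Combinatorics.Multiset_Permutations"
begin

text \<open>
  A linear order on a finite set \<open>K\<close> is the word listing \<open>K\<close> increasingly, so that \<open>L[K]\<close> is
  \<^term>\<open>permutations_of_set K\<close>; the restriction of an order to \<open>J\<close> is a subword.  An arc from
  \<open>i\<close> to \<open>j\<close> is the pair \<open>(i, j)\<close>.
\<close>

definition precedes :: "'a list \<Rightarrow> 'a \<Rightarrow> 'a \<Rightarrow> bool" where
  "precedes \<phi> i j \<longleftrightarrow> (\<exists>a b. a < b \<and> b < length \<phi> \<and> \<phi> ! a = i \<and> \<phi> ! b = j)"

definition restrict_order :: "'a list \<Rightarrow> 'a set \<Rightarrow> 'a list" where
  "restrict_order \<phi> J = filter (\<lambda>x. x \<in> J) \<phi>"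

definition set_composition :: "'a set list \<Rightarrow> 'a set \<Rightarrow> bool" where
  "set_composition Js K \<longleftrightarrow>
     (\<forall>J \<in> set Js. J \<noteq> {}) \<and>
     (\<forall>a < length Js. \<forall>b < length Js. a \<noteq> b \<longrightarrow> Js ! a \<inter> Js ! b = {}) \<and>
     \<Union> (set Js) = K"

definition set_partitions :: "'a list \<Rightarrow> ('a \<times> 'a) set set" where
  "set_partitions \<phi> =
     {lam. (\<forall>(i, j) \<in> lam. precedes \<phi> i j) \<and>
           (\<forall>(i, l) \<in> lam. \<forall>(j, k) \<in> lam. i = j \<longleftrightarrow> k = l)}"

definition arcs_on :: "('a \<times> 'a) set \<Rightarrow> 'a set \<Rightarrow> ('a \<times> 'a) set" where
  "arcs_on lam J = {(i, j) \<in> lam. i \<in> J \<and> j \<in> J}"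

definition nst :: "'a list \<Rightarrow> ('a \<times> 'a) set \<Rightarrow> ('a \<times> 'a) set \<Rightarrow> nat" where
  "nst \<phi> lam mu =
     card {((i, l), (j, k)) | i l j k. (i, l) \<in> lam \<and> (j, k) \<in> mu \<and>
             precedes \<phi> i j \<and> precedes \<phi> j k \<and> precedes \<phi> k l}"

text \<open>
  A matrix indexed by a finite set \<open>K\<close> is a function of two indices that vanishes outside
  \<open>K \<times> K\<close>, so that matrices indexed by different sets live in one type.
\<close>

type_synonym ('a, 'f) matr = "'a \<Rightarrow> 'a \<Rightarrow> 'f"

definition matr_on :: "'a set \<Rightarrow> ('a, 'f::zero) matr \<Rightarrow> bool" where
  "matr_on K u \<longleftrightarrow> (\<forall>i j. i \<notin> K \<or> j \<notin> K \<longrightarrow> u i j = 0)"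

definition diag_matr :: "'a set \<Rightarrow> ('a \<Rightarrow> 'f) \<Rightarrow> ('a, 'f::zero) matr" where
  "diag_matr K t = (\<lambda>i j. if i = j \<and> i \<in> K then t i else 0)"

definition one_matr :: "'a set \<Rightarrow> ('a, 'f::zero_neq_one) matr" where
  "one_matr K = diag_matr K (\<lambda>_. 1)"

definition mult_matr ::
  "'a set \<Rightarrow> ('a, 'f::semiring_0) matr \<Rightarrow> ('a, 'f) matr \<Rightarrow> ('a, 'f) matr" where
  "mult_matr K u v = (\<lambda>i j. \<Sum>k\<in>K. u i k * v k j)"

definition minus_matr :: "('a, 'f::minus) matr \<Rightarrow> ('a, 'f) matr \<Rightarrow> ('a, 'f) matr" where
  "minus_matr u v = (\<lambda>i j. u i j - v i j)"

definition inverse_matr :: "'a set \<Rightarrow> ('a, 'f::semiring_1) matr \<Rightarrow> ('a, 'f) matr \<Rightarrow> bool" where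
  "inverse_matr K u v \<longleftrightarrow>
     matr_on K v \<and> mult_matr K u v = one_matr K \<and> mult_matr K v u = one_matr K"

definition U :: "'a list \<Rightarrow> ('a, 'f::field) matr set" where
  "U \<phi> = {u. matr_on (set \<phi>) u \<and> (\<exists>v. inverse_matr (set \<phi>) u v) \<and>
             (\<forall>i \<in> set \<phi>. u i i = 1) \<and>
             (\<forall>i j. \<not> (i = j \<or> precedes \<phi> i j) \<longrightarrow> u i j = 0)}"

text \<open>In the next definition \<open>c\<close> is the inverse of \<open>b\<close>.\<close>

definition same_superclass ::
  "'a list \<Rightarrow> ('a, 'f::field) matr \<Rightarrow> ('a, 'f) matr \<Rightarrow> bool" where
  "same_superclass \<phi> u v \<longleftrightarrow>
     (let K = set \<phi> in
      \<exists>a \<in> U \<phi>. \<exists>b \<in> U \<phi>. \<exists>c t. inverse_matr K b c \<and> (\<forall>i \<in> K. t i \<noteq> 0) \<and>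
        minus_matr v (one_matr K) =
          mult_matr K (diag_matr K t) (mult_matr K a (mult_matr K (minus_matr u (one_matr K))
            (mult_matr K c (diag_matr K (\<lambda>i. inverse (t i)))))))"

definition superclass_rep :: "'a list \<Rightarrow> ('a \<times> 'a) set \<Rightarrow> ('a, 'f::field) matr" where
  "superclass_rep \<phi> mu = (\<lambda>i j. one_matr (set \<phi>) i j + (if (i, j) \<in> mu then 1 else 0))"

text \<open>
  The direct sum of the spaces \<open>scf\<close> over all orders on \<open>K\<close> is realised inside the
  functions of a pair (order \<open>\<phi>\<close>, element of \<open>U \<phi>\<close>), extended by zero to all pairs.  Since all
  groups are finite, the tensor product of function spaces is the space of functions of a tuple
  of such pairs; tensors of every rank share one type by taking the tuple to be a list.
\<close>

type_synonym ('a, 'f) point = "'a list \<times> ('a, 'f) matr"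
type_synonym ('a, 'f) func = "('a, 'f) point \<Rightarrow> complex"
type_synonym ('a, 'f) tens = "('a, 'f) point list \<Rightarrow> complex"

definition tensor :: "('a, 'f) func list \<Rightarrow> ('a, 'f) tens" where
  "tensor fs = (\<lambda>xs. if length xs = length fs then (\<Prod>k < length fs. (fs ! k) (xs ! k)) else 0)"

definition kappa :: "'a list \<Rightarrow> ('a \<times> 'a) set \<Rightarrow> ('a, 'f::field) func" where
  "kappa \<phi> mu = (\<lambda>(\<psi>, u).
     if \<psi> = \<phi> \<and> u \<in> U \<phi> \<and> same_superclass \<phi> (superclass_rep \<phi> mu) u then 1 else 0)"

definition P_elem :: "nat \<Rightarrow> 'a list \<Rightarrow> ('a \<times> 'a) set \<Rightarrow> ('a, 'f::field) func" where
  "P_elem q \<phi> lam = (\<lambda>x. \<Sum>mu | mu \<in> set_partitions \<phi> \<and> lam \<subseteq> mu.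
     1 / of_nat q ^ nst \<phi> lam (mu - lam) * kappa \<phi> mu x)"

definition block_matr ::
  "'a set \<Rightarrow> 'a set \<Rightarrow> ('a, 'f::zero) matr \<Rightarrow> ('a, 'f) matr \<Rightarrow> ('a, 'f) matr" where
  "block_matr I J u v = (\<lambda>i j. if i \<in> I \<and> j \<in> I then u i j
                              else if i \<in> J \<and> j \<in> J then v i j else 0)"

text \<open>
  The coproduct restricts the component of \<open>f\<close> at an order \<open>\<phi>\<close> on \<open>I \<union> J\<close> to the block-diagonal
  subgroup and puts the result into the component at the pair of restrictions of \<open>\<phi>\<close> to \<open>I\<close> and
  \<open>J\<close>; the value at a pair of orders thus collects all \<open>\<phi>\<close> restricting to that pair.
\<close>

definition coprod :: "'a set \<Rightarrow> 'a set \<Rightarrow> ('a, 'f::field) func \<Rightarrow>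
    ('a, 'f) point \<Rightarrow> ('a, 'f) point \<Rightarrow> complex" where
  "coprod I J f = (\<lambda>(\<alpha>, u) (\<beta>, v).
     if u \<in> U \<alpha> \<and> v \<in> U \<beta>
     then (\<Sum>\<phi> | \<phi> \<in> permutations_of_set (I \<union> J) \<and>
                 restrict_order \<phi> I = \<alpha> \<and> restrict_order \<phi> J = \<beta>.
             f (\<phi>, block_matr I J u v))
     else 0)"

text \<open>The coproduct tensored with identities: it acts on the first tensor factor.\<close>

definition coprod_first :: "'a set \<Rightarrow> 'a set \<Rightarrow> ('a, 'f::field) tens \<Rightarrow> ('a, 'f) tens" where
  "coprod_first I J F = (\<lambda>xs. case xs of
     x # y # zs \<Rightarrow> coprod I J (\<lambda>w. F (w # zs)) x y
   | _ \<Rightarrow> 0)"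

text \<open>
  For \<open>I\<close> and \<open>Js = [J\<^sub>1, \<dots>, J\<^sub>m]\<close>: first split \<open>J\<^sub>m\<close> off \<open>I \<union> J\<^sub>1 \<union> \<dots> \<union> J\<^sub>m\<close>, then
  \<open>J\<^sub>m\<^sub>-\<^sub>1\<close> off the first factor, and so on down to \<open>J\<^sub>1\<close> off \<open>I \<union> J\<^sub>1\<close>.
\<close>

primrec iter_coprod :: "'a set \<Rightarrow> 'a set list \<Rightarrow> ('a, 'f::field) tens \<Rightarrow> ('a, 'f) tens" where
  "iter_coprod I [] F = F"
| "iter_coprod I (J # Js) F = coprod_first I J (iter_coprod (I \<union> J) Js F)"

text \<open>
  The empty composition occurs only for \<open>K = {}\<close>; there the iterated coproduct is the counit
  (evaluation at the only element of the trivial group), with values in tensors of rank 0.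
\<close>

fun coprod_comp :: "'a set list \<Rightarrow> ('a, 'f::field) func \<Rightarrow> ('a, 'f) tens" where
  "coprod_comp [] f = (\<lambda>xs. if xs = [] then f ([], one_matr {}) else 0)"
| "coprod_comp (J # Js) f = iter_coprod J Js (tensor [f])"

definition coeff_a ::
  "nat \<Rightarrow> 'a list \<Rightarrow> 'a set list \<Rightarrow> ('a \<times> 'a) set \<Rightarrow> ('a \<times> 'a) set \<Rightarrow> complex" where
  "coeff_a q \<phi> Js lam mu =
     (\<Prod>k < length Js. \<Prod>arc \<in> arcs_on mu (Js ! k) - lam.
        1 / of_nat q ^ nst \<phi> lam {arc} - 1 / of_nat q ^ nst \<phi> (arcs_on mu (Js ! k)) {arc})"

end

theory Submission
  imports Defs
begin

text \<open>
  Row and column reduction shows that every element of \<open>U \<phi>\<close> lies in the superclass of exactly one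
  set partition, its arc type, and the arc type of a block-diagonal matrix is the union of the arc
  types of its blocks.  Both sides of the claim can therefore be compared pointwise: at a tuple of
  matrices whose arc types have union \<open>nu\<close>, the left-hand side is \<open>q ^ (- nst lam (nu - lam))\<close> if
  \<open>lam \<subseteq> nu\<close> and 0 otherwise, and the right-hand side is a sum over the arc sets \<open>mu\<close> between \<open>lam\<close> and
  \<open>nu\<close>.  Its summands are products over the arcs \<open>e \<in> nu - lam\<close>, with factor \<open>x e - y e mu\<close> if \<open>e \<in> mu\<close>
  and \<open>y e mu\<close> otherwise, where \<open>x e = q ^ (- nst lam {e})\<close>.  As \<open>y e mu\<close> depends only on the arcs
  of \<open>mu\<close> around \<open>e\<close>, summing over the arcs from the innermost outwards gives the product of the \<open>x e\<close>.
\<close>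

section \<open>Orders and set partitions\<close>

lemma precedes_Cons: "precedes (x # \<phi>) i j \<longleftrightarrow> i = x \<and> j \<in> set \<phi> \<or> precedes \<phi> i j"
proof
  assume "precedes (x # \<phi>) i j"
  then obtain a b where ab: "a < b" "b < Suc (length \<phi>)" "(x # \<phi>) ! a = i" "(x # \<phi>) ! b = j"
    by (auto simp: precedes_def)
  then obtain b' where b: "b = Suc b'" by (cases b) auto
  show "i = x \<and> j \<in> set \<phi> \<or> precedes \<phi> i j"
  proof (cases a)
    case 0
    then show ?thesis using ab b by auto
  next
    case (Suc a')
    then show ?thesis using ab b unfolding precedes_def by auto
  qed
next
  assume "i = x \<and> j \<in> set \<phi> \<or> precedes \<phi> i j"
  then show "precedes (x # \<phi>) i j"
  proof
    assume "i = x \<and> j \<in> set \<phi>"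
    then obtain b where "b < length \<phi>" "\<phi> ! b = j" "i = x" by (auto simp: in_set_conv_nth)
    then show ?thesis unfolding precedes_def by (intro exI[of _ 0] exI[of _ "Suc b"]) auto
  next
    assume "precedes \<phi> i j"
    then obtain a b where "a < b" "b < length \<phi>" "\<phi> ! a = i" "\<phi> ! b = j"
      by (auto simp: precedes_def)
    then show ?thesis unfolding precedes_def by (intro exI[of _ "Suc a"] exI[of _ "Suc b"]) auto
  qed
qed

lemma precedes_Nil [simp]: "\<not> precedes [] i j"
  by (simp add: precedes_def)

lemma precedes_in_set: "precedes \<phi> i j \<Longrightarrow> i \<in> set \<phi> \<and> j \<in> set \<phi>"
  by (induction \<phi>) (auto simp: precedes_Cons)

lemma precedes_irrefl: "distinct \<phi> \<Longrightarrow> \<not> precedes \<phi> i i"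
  by (induction \<phi>) (auto simp: precedes_Cons)

lemma precedes_trans: "distinct \<phi> \<Longrightarrow> precedes \<phi> i j \<Longrightarrow> precedes \<phi> j k \<Longrightarrow> precedes \<phi> i k"
  by (induction \<phi>) (auto simp: precedes_Cons dest: precedes_in_set)

lemma precedes_restrict_order:
  "precedes (restrict_order \<phi> J) i j \<longleftrightarrow> i \<in> J \<and> j \<in> J \<and> precedes \<phi> i j"
  unfolding restrict_order_def by (induction \<phi>) (auto simp: precedes_Cons)

lemma set_restrict_order [simp]: "set (restrict_order \<phi> J) = set \<phi> \<inter> J"
  by (auto simp: restrict_order_def)

lemma distinct_restrict_order [simp]: "distinct \<phi> \<Longrightarrow> distinct (restrict_order \<phi> J)"
  by (simp add: restrict_order_def)

lemma restrict_order_restrict_order: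
  "restrict_order (restrict_order \<phi> I) J = restrict_order \<phi> (I \<inter> J)"
  by (simp add: restrict_order_def conj_commute)

lemma set_partitions_precedes: "mu \<in> set_partitions \<phi> \<Longrightarrow> (i, j) \<in> mu \<Longrightarrow> precedes \<phi> i j"
  by (auto simp: set_partitions_def)

lemma set_partitions_subset: "mu \<in> set_partitions \<phi> \<Longrightarrow> mu \<subseteq> set \<phi> \<times> set \<phi>"
  by (auto dest: set_partitions_precedes precedes_in_set)

lemma finite_set_partitions [simp]: "finite (set_partitions \<phi>)"
  by (rule finite_subset[of _ "Pow (set \<phi> \<times> set \<phi>)"]) (auto dest: set_partitions_subset)

lemma finite_set_partition: "mu \<in> set_partitions \<phi> \<Longrightarrow> finite mu"
  by (rule finite_subset[OF set_partitions_subset]) auto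

lemma set_partitions_mono: "mu \<in> set_partitions \<phi> \<Longrightarrow> lam \<subseteq> mu \<Longrightarrow> lam \<in> set_partitions \<phi>"
  unfolding set_partitions_def by blast

lemma set_partitions_left_unique:
  "mu \<in> set_partitions \<phi> \<Longrightarrow> (i, k) \<in> mu \<Longrightarrow> (i, l) \<in> mu \<Longrightarrow> k = l"
  unfolding set_partitions_def by blast

lemma set_partitions_right_unique:
  "mu \<in> set_partitions \<phi> \<Longrightarrow> (i, k) \<in> mu \<Longrightarrow> (j, k) \<in> mu \<Longrightarrow> i = j"
  unfolding set_partitions_def by blast

section \<open>Triangular matrices and superclasses\<close>

lemma mult_matr_assoc:
  assumes "finite K"
  shows "mult_matr K (mult_matr K u v) w = mult_matr K u (mult_matr K v w)"
proof (intro ext)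
  fix i j
  have "(\<Sum>k\<in>K. (\<Sum>l\<in>K. u i l * v l k) * w k j) = (\<Sum>k\<in>K. \<Sum>l\<in>K. u i l * (v l k * w k j))"
    by (simp add: sum_distrib_right mult.assoc)
  also have "\<dots> = (\<Sum>l\<in>K. \<Sum>k\<in>K. u i l * (v l k * w k j))"
    by (rule sum.swap)
  also have "\<dots> = (\<Sum>l\<in>K. u i l * (\<Sum>k\<in>K. v l k * w k j))"
    by (simp add: sum_distrib_left)
  finally show "mult_matr K (mult_matr K u v) w i j = mult_matr K u (mult_matr K v w) i j"
    by (simp add: mult_matr_def)
qed

lemma mult_diag_left:
  fixes u :: "('a, 'f::semiring_1) matr"
  assumes "finite K"
  shows "mult_matr K (diag_matr K t) u = (\<lambda>i j. if i \<in> K then t i * u i j else 0)"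
proof (intro ext)
  fix i j
  have "mult_matr K (diag_matr K t) u i j = (\<Sum>k\<in>K. if k = i then t i * u i j else 0)"
    unfolding mult_matr_def diag_matr_def by (rule sum.cong) auto
  then show "mult_matr K (diag_matr K t) u i j = (if i \<in> K then t i * u i j else 0)"
    using assms by simp
qed

lemma mult_diag_right:
  fixes u :: "('a, 'f::semiring_1) matr"
  assumes "finite K"
  shows "mult_matr K u (diag_matr K t) = (\<lambda>i j. if j \<in> K then u i j * t j else 0)"
proof (intro ext)
  fix i j
  have "mult_matr K u (diag_matr K t) i j = (\<Sum>k\<in>K. if k = j then u i j * t j else 0)"
    unfolding mult_matr_def diag_matr_def by (rule sum.cong) auto
  then show "mult_matr K u (diag_matr K t) i j = (if j \<in> K then u i j * t j else 0)"
    using assms by simp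
qed

lemma mult_one_left:
  fixes u :: "('a, 'f::semiring_1) matr"
  assumes "finite K" "matr_on K u"
  shows "mult_matr K (one_matr K) u = u"
  using assms unfolding one_matr_def mult_diag_left[OF assms(1)] by (auto simp: matr_on_def fun_eq_iff)

lemma mult_one_right:
  fixes u :: "('a, 'f::semiring_1) matr"
  assumes "finite K" "matr_on K u"
  shows "mult_matr K u (one_matr K) = u"
  using assms unfolding one_matr_def mult_diag_right[OF assms(1)] by (auto simp: matr_on_def fun_eq_iff)

lemma matr_on_mult: "matr_on K u \<Longrightarrow> matr_on K v \<Longrightarrow> matr_on K (mult_matr K u v)"
  unfolding matr_on_def mult_matr_def by (auto intro!: sum.neutral)

lemma matr_on_one: "matr_on K (one_matr K)"
  by (auto simp: matr_on_def one_matr_def diag_matr_def)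

lemma matr_on_minus:
  fixes u :: "('a, 'f::ab_group_add) matr"
  shows "matr_on K u \<Longrightarrow> matr_on K v \<Longrightarrow> matr_on K (minus_matr u v)"
  unfolding matr_on_def minus_matr_def by auto

text \<open>The diagonal is only required to be nonzero, not 1, so that one matrix absorbs both the
  unitriangular factor and the diagonal factor \<open>t\<close> of the superclass relation.\<close>

definition triangular :: "'a list \<Rightarrow> ('a, 'f::zero) matr \<Rightarrow> bool" where
  "triangular \<phi> A \<longleftrightarrow> matr_on (set \<phi>) A \<and> (\<forall>i\<in>set \<phi>. A i i \<noteq> 0) \<and>
     (\<forall>i j. A i j \<noteq> 0 \<longrightarrow> i = j \<or> precedes \<phi> i j)"

lemma triangular_one: "triangular \<phi> (one_matr (set \<phi>) :: ('a, 'f::zero_neq_one) matr)"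
  by (auto simp: triangular_def matr_on_def one_matr_def diag_matr_def)

text \<open>A summand with \<open>k \<noteq> i\<close> would need \<open>i\<close> before
  \<open>k\<close> before \<open>i\<close>, so only \<open>k = i\<close> survives.\<close>

lemma triangular_mult_diag_entry:
  fixes A B :: "('a, 'f::semiring_0) matr"
  assumes "distinct \<phi>" "triangular \<phi> A" "triangular \<phi> B" "i \<in> set \<phi>"
  shows "mult_matr (set \<phi>) A B i i = A i i * B i i"
proof -
  have "A i k * B k i = 0" if "k \<noteq> i" for k
    using assms that precedes_trans[OF assms(1), of i k i] precedes_irrefl[OF assms(1), of i]
    unfolding triangular_def by (metis mult_zero_left mult_zero_right)
  then have "mult_matr (set \<phi>) A B i i = (\<Sum>k\<in>set \<phi>. if k = i then A i i * B i i else 0)"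
    unfolding mult_matr_def by (intro sum.cong) auto
  then show ?thesis using assms(4) by simp
qed

lemma triangular_mult:
  fixes A B :: "('a, 'f::field) matr"
  assumes "distinct \<phi>" "triangular \<phi> A" "triangular \<phi> B"
  shows "triangular \<phi> (mult_matr (set \<phi>) A B)"
  unfolding triangular_def
proof (intro conjI ballI allI impI)
  show "matr_on (set \<phi>) (mult_matr (set \<phi>) A B)"
    using assms by (auto intro: matr_on_mult simp: triangular_def)
  show "mult_matr (set \<phi>) A B i i \<noteq> 0" if "i \<in> set \<phi>" for i
    using triangular_mult_diag_entry[OF assms that] assms that by (auto simp: triangular_def)
  fix i j assume "mult_matr (set \<phi>) A B i j \<noteq> 0"
  then obtain k where "A i k * B k j \<noteq> 0"
    unfolding mult_matr_def by (rule sum.not_neutral_contains_not_neutral)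
  then have "i = k \<or> precedes \<phi> i k" "k = j \<or> precedes \<phi> k j"
    using assms unfolding triangular_def by auto
  then show "i = j \<or> precedes \<phi> i j"
    using precedes_trans[OF assms(1)] by blast
qed

text \<open>Induction on the word: the column of its first letter vanishes below the diagonal. The
  remaining rows form a triangular matrix that is inverted by induction, and only the first row of
  the inverse has to be solved for.\<close>

lemma triangular_right_inverse:
  fixes A :: "('a, 'f::field) matr"
  assumes "distinct \<phi>" "triangular \<phi> A"
  shows "\<exists>C. triangular \<phi> C \<and> mult_matr (set \<phi>) A C = one_matr (set \<phi>)"
  using assms
proof (induction \<phi> arbitrary: A)
  case Nil
  show ?case
    by (intro exI[of _ "one_matr {}"])
      (auto simp: triangular_def matr_on_def one_matr_def diag_matr_def mult_matr_def fun_eq_iff)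
next
  case (Cons x \<phi>)
  define A' where "A' = (\<lambda>i j. if i = x then 0 else A i j)"
  have x: "x \<notin> set \<phi>" "distinct \<phi>" using Cons.prems by auto
  have A: "A x x \<noteq> 0" "\<And>i. i \<in> set \<phi> \<Longrightarrow> A i i \<noteq> 0"
    "\<And>i j. A i j \<noteq> 0 \<Longrightarrow> i = j \<or> i = x \<and> j \<in> set \<phi> \<or> precedes \<phi> i j"
    "\<And>i j. i \<notin> insert x (set \<phi>) \<Longrightarrow> A i j = 0"
    using Cons.prems(2) by (auto simp: triangular_def precedes_Cons matr_on_def)
  have col: "A i x = 0" if "i \<noteq> x" for i
    using A(3)[of i x] that x by (auto dest: precedes_in_set)
  have "triangular \<phi> A'"
    unfolding triangular_def
  proof (intro conjI ballI allI impI)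
    have "A i j = 0" if "i \<noteq> x" "i \<notin> set \<phi> \<or> j \<notin> set \<phi>" for i j
      using that A(3)[of i j] A(4)[of i j] precedes_in_set[of \<phi> i j] by auto
    then show "matr_on (set \<phi>) A'" by (auto simp: matr_on_def A'_def)
    show "A' i i \<noteq> 0" if "i \<in> set \<phi>" for i using A(2) that x by (auto simp: A'_def)
    show "i = j \<or> precedes \<phi> i j" if "A' i j \<noteq> 0" for i j
      using that A(3)[of i j] by (auto simp: A'_def split: if_splits)
  qed
  then obtain C' where C': "triangular \<phi> C'" "mult_matr (set \<phi>) A' C' = one_matr (set \<phi>)"
    using Cons.IH[OF x(2)] by blast
  have C'0: "C' i j = 0" if "i \<notin> set \<phi> \<or> j \<notin> set \<phi>" for i j
    using C'(1) that by (auto simp: triangular_def matr_on_def)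
  \<comment> \<open>For \<open>j \<noteq> x\<close> the entries of row \<open>x\<close> solve
    \<open>A x x * C x j + (\<Sum>k\<in>set \<phi>. A x k * C' k j) = 0\<close>.\<close>
  define C where "C = (\<lambda>i j. if i = x then (if j = x then 1 / A x x
    else - (\<Sum>k\<in>set \<phi>. A x k * C' k j) / A x x) else C' i j)"
  have "triangular (x # \<phi>) C"
    unfolding triangular_def
  proof (intro conjI ballI allI impI)
    show "matr_on (set (x # \<phi>)) C"
      by (auto simp: matr_on_def C_def C'0)
    show "C i i \<noteq> 0" if "i \<in> set (x # \<phi>)" for i
      using that A(1) C'(1) x by (auto simp: C_def triangular_def)
    fix i j assume ne: "C i j \<noteq> 0"
    show "i = j \<or> precedes (x # \<phi>) i j"
    proof (cases "i = x \<and> j \<noteq> x")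
      case True
      then have "(\<Sum>k\<in>set \<phi>. A x k * C' k j) \<noteq> 0" using ne by (auto simp: C_def)
      then obtain k where "A x k * C' k j \<noteq> 0" by (rule sum.not_neutral_contains_not_neutral)
      then have "j \<in> set \<phi>" using C'0[of k j] by auto
      then show ?thesis using True by (simp add: precedes_Cons)
    next
      case False
      then show ?thesis using ne C'(1) by (auto simp: C_def triangular_def precedes_Cons split: if_splits)
    qed
  qed
  moreover have "mult_matr (set (x # \<phi>)) A C i j = one_matr (set (x # \<phi>)) i j" for i j
  proof -
    have "mult_matr (set (x # \<phi>)) A C i j = A i x * C x j + (\<Sum>k\<in>set \<phi>. A i k * C' k j)"
      using x(1) by (simp add: mult_matr_def) (auto simp: C_def intro!: sum.cong)
    also have "\<dots> = one_matr (set (x # \<phi>)) i j"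
    proof (cases "i = x")
      case True
      then show ?thesis using A(1) C'0[of _ x] x by (auto simp: C_def one_matr_def diag_matr_def)
    next
      case False
      then have "(\<Sum>k\<in>set \<phi>. A i k * C' k j) = mult_matr (set \<phi>) A' C' i j"
        by (simp add: mult_matr_def A'_def)
      then show ?thesis using False col C'(2) by (auto simp: one_matr_def diag_matr_def)
    qed
    finally show ?thesis .
  qed
  ultimately show ?case by blast
qed

lemma right_inverse_unique:
  fixes A :: "('a, 'f::semiring_1) matr"
  assumes "finite K" "matr_on K A" "matr_on K D"
    and "mult_matr K A C = one_matr K" "mult_matr K C D = one_matr K"
  shows "A = D"
  using mult_matr_assoc[OF assms(1), of A C D] assms by (simp add: mult_one_left mult_one_right)

text \<open>The right inverse \<open>C\<close> of \<open>A\<close> has in turn a right inverse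
  \<open>D\<close>, and \<open>A = A (C D) = (A C) D = D\<close> makes \<open>C\<close>
  two-sided.\<close>

lemma triangular_inverse:
  fixes A :: "('a, 'f::field) matr"
  assumes "distinct \<phi>" "triangular \<phi> A"
  obtains C where "triangular \<phi> C" "mult_matr (set \<phi>) A C = one_matr (set \<phi>)"
    "mult_matr (set \<phi>) C A = one_matr (set \<phi>)"
proof -
  obtain C where C: "triangular \<phi> C" "mult_matr (set \<phi>) A C = one_matr (set \<phi>)"
    using triangular_right_inverse[OF assms] by blast
  obtain D where D: "triangular \<phi> D" "mult_matr (set \<phi>) C D = one_matr (set \<phi>)"
    using triangular_right_inverse[OF assms(1) C(1)] by blast
  have "A = D"
    using right_inverse_unique[of "set \<phi>" A D C] assms C D by (auto simp: triangular_def)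
  then show ?thesis using that C D by auto
qed

text \<open>The inverse demanded in \<open>U\<close> is supplied by
  \<open>triangular_inverse\<close>, so membership can be checked on entries alone.\<close>

lemma U_iff:
  fixes u :: "('a, 'f::field) matr"
  assumes "distinct \<phi>"
  shows "u \<in> U \<phi> \<longleftrightarrow> triangular \<phi> u \<and> (\<forall>i\<in>set \<phi>. u i i = 1)"
proof
  assume "u \<in> U \<phi>"
  then show "triangular \<phi> u \<and> (\<forall>i\<in>set \<phi>. u i i = 1)"
    by (auto simp: U_def triangular_def)
next
  assume u: "triangular \<phi> u \<and> (\<forall>i\<in>set \<phi>. u i i = 1)"
  then obtain C where "triangular \<phi> C" "mult_matr (set \<phi>) u C = one_matr (set \<phi>)"
    "mult_matr (set \<phi>) C u = one_matr (set \<phi>)"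
    using triangular_inverse[OF assms, of u] by blast
  then have "\<exists>v. inverse_matr (set \<phi>) u v"
    unfolding inverse_matr_def triangular_def by blast
  then show "u \<in> U \<phi>" using u unfolding U_def triangular_def by auto
qed

text \<open>
  Writing the superclass relation with the inverse cleared from the right-hand side leaves pairs
  \<open>(t a, t b)\<close>, which are the pairs of triangular matrices with the same diagonal.
\<close>

definition intertwined :: "'a list \<Rightarrow> ('a, 'f::field) matr \<Rightarrow> ('a, 'f) matr \<Rightarrow> bool" where
  "intertwined \<phi> X Y \<longleftrightarrow> (\<exists>A B. triangular \<phi> A \<and> triangular \<phi> B \<and> (\<forall>i\<in>set \<phi>. A i i = B i i) \<and>
     mult_matr (set \<phi>) A X = mult_matr (set \<phi>) Y B)"

text \<open>From \<open>A X = Y B\<close> and \<open>A' Y = Z B'\<close> follows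
  \<open>(A' A) X = Z (B' B)\<close>, and diagonals of triangular matrices multiply
  entrywise.\<close>

lemma intertwined_trans:
  fixes X Y Z :: "('a, 'f::field) matr"
  assumes \<phi>: "distinct \<phi>" and "intertwined \<phi> X Y" "intertwined \<phi> Y Z"
  shows "intertwined \<phi> X Z"
proof -
  obtain A B where AB: "triangular \<phi> A" "triangular \<phi> B" "\<forall>i\<in>set \<phi>. A i i = B i i"
    "mult_matr (set \<phi>) A X = mult_matr (set \<phi>) Y B"
    using assms(2) unfolding intertwined_def by blast
  obtain A' B' where AB': "triangular \<phi> A'" "triangular \<phi> B'" "\<forall>i\<in>set \<phi>. A' i i = B' i i"
    "mult_matr (set \<phi>) A' Y = mult_matr (set \<phi>) Z B'"
    using assms(3) unfolding intertwined_def by blast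
  have "mult_matr (set \<phi>) (mult_matr (set \<phi>) A' A) X = mult_matr (set \<phi>) (mult_matr (set \<phi>) A' Y) B"
    by (simp add: mult_matr_assoc[OF finite_set] AB(4))
  also have "\<dots> = mult_matr (set \<phi>) Z (mult_matr (set \<phi>) B' B)"
    unfolding AB'(4) by (rule mult_matr_assoc[OF finite_set])
  finally have "mult_matr (set \<phi>) (mult_matr (set \<phi>) A' A) X = mult_matr (set \<phi>) Z (mult_matr (set \<phi>) B' B)" .
  moreover have "triangular \<phi> (mult_matr (set \<phi>) A' A)" "triangular \<phi> (mult_matr (set \<phi>) B' B)"
    using AB AB' by (auto intro: triangular_mult[OF \<phi>])
  moreover have "\<forall>i\<in>set \<phi>. mult_matr (set \<phi>) A' A i i = mult_matr (set \<phi>) B' B i i"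
    using AB AB' by (simp add: triangular_mult_diag_entry[OF \<phi>])
  ultimately show ?thesis unfolding intertwined_def by blast
qed

text \<open>With inverses \<open>C\<close> of \<open>A\<close> and \<open>D\<close> of
  \<open>B\<close>, the relation \<open>A X = Y B\<close> turns into \<open>C Y = X D\<close>. The
  support assumptions let \<open>one_matr\<close> act as the identity on \<open>X\<close> and
  \<open>Y\<close>.\<close>

lemma intertwined_sym:
  fixes X Y :: "('a, 'f::field) matr"
  assumes \<phi>: "distinct \<phi>" and X: "matr_on (set \<phi>) X" and Y: "matr_on (set \<phi>) Y"
    and "intertwined \<phi> X Y"
  shows "intertwined \<phi> Y X"
proof -
  obtain A B where AB: "triangular \<phi> A" "triangular \<phi> B" "\<forall>i\<in>set \<phi>. A i i = B i i"
    "mult_matr (set \<phi>) A X = mult_matr (set \<phi>) Y B"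
    using assms(4) unfolding intertwined_def by blast
  obtain C where C: "triangular \<phi> C" "mult_matr (set \<phi>) A C = one_matr (set \<phi>)"
    "mult_matr (set \<phi>) C A = one_matr (set \<phi>)" using triangular_inverse[OF \<phi> AB(1)] by blast
  obtain D where D: "triangular \<phi> D" "mult_matr (set \<phi>) B D = one_matr (set \<phi>)"
    "mult_matr (set \<phi>) D B = one_matr (set \<phi>)" using triangular_inverse[OF \<phi> AB(2)] by blast
  have "C i i = D i i" if i: "i \<in> set \<phi>" for i
  proof -
    have "A i i * C i i = 1" "B i i * D i i = 1"
      using triangular_mult_diag_entry[OF \<phi> AB(1) C(1) i] triangular_mult_diag_entry[OF \<phi> AB(2) D(1) i]
        C(2) D(2) i by (auto simp: one_matr_def diag_matr_def)
    then show ?thesis using AB(3) i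
      by (metis mult_cancel_left mult_zero_left zero_neq_one)
  qed
  moreover have "mult_matr (set \<phi>) C Y = mult_matr (set \<phi>) X D"
  proof -
    have "mult_matr (set \<phi>) C Y = mult_matr (set \<phi>) C (mult_matr (set \<phi>) (mult_matr (set \<phi>) Y B) D)"
      using Y by (simp add: mult_matr_assoc[OF finite_set] D mult_one_right)
    also have "\<dots> = mult_matr (set \<phi>) (mult_matr (set \<phi>) C A) (mult_matr (set \<phi>) X D)"
      unfolding AB(4)[symmetric] by (simp add: mult_matr_assoc[OF finite_set])
    also have "\<dots> = mult_matr (set \<phi>) X D"
      using X D(1) by (simp add: C mult_one_left matr_on_mult triangular_def)
    finally show ?thesis .
  qed
  ultimately show ?thesis using C(1) D(1) unfolding intertwined_def by blast
qed

lemma triangular_scale: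
  fixes A :: "('a, 'f::field) matr"
  assumes "triangular \<phi> A" "\<And>i. i \<in> set \<phi> \<Longrightarrow> s i \<noteq> 0"
  shows "triangular \<phi> (mult_matr (set \<phi>) (diag_matr (set \<phi>) s) A)"
  using assms unfolding triangular_def mult_diag_left[OF finite_set] matr_on_def by auto

lemma same_superclass_iff:
  fixes u v :: "('a, 'f::field) matr"
  assumes \<phi>: "distinct \<phi>" and u: "matr_on (set \<phi>) u" and v: "matr_on (set \<phi>) v"
  shows "same_superclass \<phi> u v \<longleftrightarrow>
    intertwined \<phi> (minus_matr u (one_matr (set \<phi>))) (minus_matr v (one_matr (set \<phi>)))"
proof -
  let ?K = "set \<phi>"
  let ?X = "minus_matr u (one_matr ?K)" and ?Y = "minus_matr v (one_matr ?K)"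
  have X: "matr_on ?K ?X" and Y: "matr_on ?K ?Y"
    using u v by (auto intro: matr_on_minus matr_on_one)
  show ?thesis
  proof
    assume "same_superclass \<phi> u v"
    then obtain a b c t where ab: "a \<in> U \<phi>" "b \<in> U \<phi>" "inverse_matr ?K b c" "\<forall>i\<in>?K. t i \<noteq> 0"
      and eq: "?Y = mult_matr ?K (diag_matr ?K t) (mult_matr ?K a (mult_matr ?K ?X
        (mult_matr ?K c (diag_matr ?K (\<lambda>i. inverse (t i))))))"
      unfolding same_superclass_def Let_def by blast
    let ?A = "mult_matr ?K (diag_matr ?K t) a" and ?B = "mult_matr ?K (diag_matr ?K t) b"
    have ab': "triangular \<phi> a" "triangular \<phi> b" "\<forall>i\<in>?K. a i i = 1" "\<forall>i\<in>?K. b i i = 1"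
      using ab U_iff[OF \<phi>] by auto
    \<comment> \<open>Multiplying \<open>?Y\<close> on the right by \<open>?B\<close>, which is
      \<open>t b\<close>, cancels the trailing inverse of \<open>t\<close>; then \<open>c\<close>
      meets \<open>b\<close>.\<close>
    have tt: "mult_matr ?K (diag_matr ?K (\<lambda>i. inverse (t i))) ?B = b"
      using ab(4) ab'(2) by (auto simp: mult_diag_left fun_eq_iff triangular_def matr_on_def)
    have "mult_matr ?K ?Y ?B = mult_matr ?K ?A (mult_matr ?K ?X (mult_matr ?K c
       (mult_matr ?K (diag_matr ?K (\<lambda>i. inverse (t i))) ?B)))"
      by (subst eq) (simp add: mult_matr_assoc)
    also have "\<dots> = mult_matr ?K ?A ?X"
      unfolding tt using ab(3) X by (simp add: inverse_matr_def mult_one_right)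
    finally have "mult_matr ?K ?A ?X = mult_matr ?K ?Y ?B" by simp
    moreover have "triangular \<phi> ?A" "triangular \<phi> ?B"
      using ab' ab(4) by (auto intro: triangular_scale)
    moreover have "\<forall>i\<in>?K. ?A i i = ?B i i"
      using ab' by (simp add: mult_diag_left)
    ultimately show "intertwined \<phi> ?X ?Y" unfolding intertwined_def by blast
  next
    assume "intertwined \<phi> ?X ?Y"
    then obtain A B where AB: "triangular \<phi> A" "triangular \<phi> B" "\<forall>i\<in>?K. A i i = B i i"
      "mult_matr ?K A ?X = mult_matr ?K ?Y B"
      unfolding intertwined_def by blast
    obtain D where D: "triangular \<phi> D" "mult_matr ?K B D = one_matr ?K"
      "mult_matr ?K D B = one_matr ?K" using triangular_inverse[OF \<phi> AB(2)] by blast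
    \<comment> \<open>The torus element is the common diagonal of \<open>A\<close> and
      \<open>B\<close>; dividing it out makes both unitriangular.\<close>
    define t where "t = (\<lambda>i. A i i)"
    have t: "\<forall>i\<in>?K. t i \<noteq> 0" using AB(1) by (auto simp: t_def triangular_def)
    let ?T = "diag_matr ?K t" and ?S = "diag_matr ?K (\<lambda>i. inverse (t i))"
    define a where "a = mult_matr ?K ?S A"
    define b where "b = mult_matr ?K ?S B"
    define c where "c = mult_matr ?K D ?T"
    have TS: "mult_matr ?K ?T ?S = one_matr ?K" "mult_matr ?K ?S ?T = one_matr ?K"
      unfolding mult_diag_left[OF finite_set] using t
      by (auto simp: one_matr_def diag_matr_def fun_eq_iff)
    have on: "matr_on ?K A" "matr_on ?K B" "matr_on ?K D" "matr_on ?K ?T" "matr_on ?K ?S"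
      using AB D by (auto simp: triangular_def matr_on_def diag_matr_def)
    have "triangular \<phi> a" "triangular \<phi> b"
      using AB t by (auto simp: a_def b_def intro!: triangular_scale)
    moreover have "\<forall>i\<in>?K. a i i = 1 \<and> b i i = 1"
      using AB(3) t by (auto simp: a_def b_def mult_diag_left t_def)
    ultimately have "a \<in> U \<phi>" "b \<in> U \<phi>"
      unfolding U_iff[OF \<phi>] by auto
    moreover have "inverse_matr ?K b c"
      unfolding inverse_matr_def
    proof (intro conjI)
      show "matr_on ?K c" using on by (simp add: c_def matr_on_mult)
      have "mult_matr ?K b c = mult_matr ?K ?S (mult_matr ?K (mult_matr ?K B D) ?T)"
        by (simp add: b_def c_def mult_matr_assoc)
      also have "\<dots> = one_matr ?K" using on by (simp add: D TS mult_one_left)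
      finally show "mult_matr ?K b c = one_matr ?K" .
      have "mult_matr ?K c b = mult_matr ?K D (mult_matr ?K (mult_matr ?K ?T ?S) B)"
        by (simp add: b_def c_def mult_matr_assoc)
      also have "\<dots> = one_matr ?K" using on by (simp add: D TS mult_one_left)
      finally show "mult_matr ?K c b = one_matr ?K" .
    qed
    moreover have "?Y = mult_matr ?K ?T (mult_matr ?K a (mult_matr ?K ?X (mult_matr ?K c ?S)))"
    proof -
      have "mult_matr ?K ?T (mult_matr ?K a (mult_matr ?K ?X (mult_matr ?K c ?S)))
         = mult_matr ?K (mult_matr ?K (mult_matr ?K ?T ?S) (mult_matr ?K A ?X)) (mult_matr ?K D (mult_matr ?K ?T ?S))"
        by (simp add: a_def c_def mult_matr_assoc)
      also have "\<dots> = mult_matr ?K (mult_matr ?K A ?X) D"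
        using on X by (simp add: TS mult_one_left mult_one_right matr_on_mult)
      also have "\<dots> = ?Y" unfolding AB(4) using Y by (simp add: mult_matr_assoc D mult_one_right)
      finally show ?thesis by simp
    qed
    ultimately show "same_superclass \<phi> u v"
      unfolding same_superclass_def Let_def using t by blast
  qed
qed

section \<open>Arc matrices as normal forms of superclasses\<close>

definition arc_matr :: "('a \<times> 'a) set \<Rightarrow> ('a, 'f::zero_neq_one) matr" where
  "arc_matr mu = (\<lambda>i j. if (i, j) \<in> mu then 1 else 0)"

lemma matr_on_arc_matr: "mu \<in> set_partitions \<phi> \<Longrightarrow> matr_on (set \<phi>) (arc_matr mu)"
  using set_partitions_subset by (force simp: matr_on_def arc_matr_def)

text \<open>At most one arc starts at \<open>i\<close>, so the sum for an entry in row
  \<open>i\<close> has a single term.\<close>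

lemma mult_arc_matr_left:
  fixes B :: "('a, 'f::field) matr"
  assumes mu: "mu \<in> set_partitions \<phi>" and arc: "(i, k) \<in> mu"
  shows "mult_matr (set \<phi>) (arc_matr mu) B i l = B k l"
proof -
  have "mult_matr (set \<phi>) (arc_matr mu) B i l = (\<Sum>m\<in>set \<phi>. if m = k then B k l else 0)"
    unfolding mult_matr_def arc_matr_def using set_partitions_left_unique[OF mu] arc
    by (intro sum.cong) auto
  then show ?thesis using set_partitions_subset[OF mu] arc by auto
qed

lemma mult_arc_matr_right:
  fixes A :: "('a, 'f::field) matr"
  assumes mu: "mu \<in> set_partitions \<phi>" and arc: "(k, l) \<in> mu"
  shows "mult_matr (set \<phi>) A (arc_matr mu) i l = A i k"
proof -
  have "mult_matr (set \<phi>) A (arc_matr mu) i l = (\<Sum>m\<in>set \<phi>. if m = k then A i k else 0)"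
    unfolding mult_matr_def arc_matr_def using set_partitions_right_unique[OF mu] arc
    by (intro sum.cong) auto
  then show ?thesis using set_partitions_subset[OF mu] arc by auto
qed

lemma mult_arc_matr_left_eq_0:
  fixes B :: "('a, 'f::field) matr"
  assumes "\<And>k. (i, k) \<notin> mu"
  shows "mult_matr K (arc_matr mu) B i l = 0"
  using assms by (simp add: mult_matr_def arc_matr_def)

text \<open>Compare the entries at \<open>(j, l)\<close> of
  \<open>A * arc_matr mu = arc_matr nu * B\<close>. The left one is \<open>A j j\<close>, which is
  nonzero; hence some arc of \<open>nu\<close> starts at \<open>j\<close>, and its right endpoint
  \<open>k\<close> satisfies \<open>B k l \<noteq> 0\<close>.\<close>

lemma intertwined_arc_matr_shrinks:
  assumes mu: "mu \<in> set_partitions \<phi>" and nu: "nu \<in> set_partitions \<phi>"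
    and "intertwined \<phi> (arc_matr mu :: ('a, 'f::field) matr) (arc_matr nu)" and arc: "(j, l) \<in> mu"
  shows "\<exists>k. (j, k) \<in> nu \<and> (k = l \<or> precedes \<phi> k l)"
proof -
  obtain A B :: "('a, 'f) matr" where AB: "triangular \<phi> A" "triangular \<phi> B"
    "mult_matr (set \<phi>) A (arc_matr mu) = mult_matr (set \<phi>) (arc_matr nu) B"
    using assms(3) unfolding intertwined_def by blast
  have "mult_matr (set \<phi>) (arc_matr nu) B j l = A j j"
    using mult_arc_matr_right[OF mu arc] AB(3) by metis
  moreover have "A j j \<noteq> 0"
    using AB(1) set_partitions_subset[OF mu] arc by (auto simp: triangular_def)
  ultimately obtain k where k: "(j, k) \<in> nu"
    using mult_arc_matr_left_eq_0 by metis
  then have "B k l \<noteq> 0"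
    using \<open>_ = A j j\<close> \<open>A j j \<noteq> 0\<close> mult_arc_matr_left[OF nu k] by metis
  then show ?thesis using k AB(2) by (auto simp: triangular_def)
qed

text \<open>The previous comparison in both directions squeezes the right endpoint of the
  \<open>nu\<close>-arc from \<open>j\<close>: it is at most \<open>l\<close>, and at least the
  right endpoint of a \<open>mu\<close>-arc from \<open>j\<close>, which is \<open>l\<close>
  again.\<close>

lemma intertwined_arc_matr_subset:
  assumes \<phi>: "distinct \<phi>" and mu: "mu \<in> set_partitions \<phi>" and nu: "nu \<in> set_partitions \<phi>"
    and tw: "intertwined \<phi> (arc_matr mu :: ('a, 'f::field) matr) (arc_matr nu)"
  shows "mu \<subseteq> nu"
proof clarify
  fix j l assume arc: "(j, l) \<in> mu"
  have tw': "intertwined \<phi> (arc_matr nu :: ('a, 'f) matr) (arc_matr mu)"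
    by (rule intertwined_sym[OF \<phi> matr_on_arc_matr[OF mu] matr_on_arc_matr[OF nu] tw])
  obtain k where k: "(j, k) \<in> nu" "k = l \<or> precedes \<phi> k l"
    using intertwined_arc_matr_shrinks[OF mu nu tw arc] by blast
  obtain l' where l': "(j, l') \<in> mu" "l' = k \<or> precedes \<phi> l' k"
    using intertwined_arc_matr_shrinks[OF nu mu tw' k(1)] by blast
  have "l' = l" using set_partitions_left_unique[OF mu l'(1) arc] .
  then have "k = l"
    using k(2) l'(2) precedes_trans[OF \<phi>] precedes_irrefl[OF \<phi>] by blast
  then show "(j, l) \<in> nu" using k by simp
qed

text \<open>
  Adding multiples of the rows of \<open>arc_matr mu * B\<close>, one arc \<open>(i, k)\<close> at a time, moves the
  leading entry of a row to the right until its column is not a right endpoint of \<open>mu\<close>.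
\<close>

lemma reduce_row:
  fixes r :: "'a \<Rightarrow> 'f::field" and A B X :: "('a, 'f) matr"
  assumes \<phi>: "distinct \<phi>" and B: "triangular \<phi> B" and mu: "mu \<in> set_partitions \<phi>"
    and eq: "mult_matr (set \<phi>) A X = mult_matr (set \<phi>) (arc_matr mu) B"
    and n: "n \<le> length \<phi>"
  defines "w \<equiv> \<lambda>\<alpha> l. r l + (\<Sum>j\<in>set \<phi>. \<alpha> j * X j l)"
  shows "\<exists>\<alpha>. (\<forall>m<n. w \<alpha> (\<phi> ! m) = 0) \<or>
    (\<exists>k\<in>set \<phi>. k \<notin> snd ` mu \<and> w \<alpha> k \<noteq> 0 \<and>
       (\<forall>l\<in>set \<phi>. w \<alpha> l \<noteq> 0 \<longrightarrow> l = k \<or> precedes \<phi> k l))"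
  using n
proof (induction n)
  case 0
  then show ?case by simp
next
  case (Suc n)
  then obtain \<alpha> where IH: "(\<forall>m<n. w \<alpha> (\<phi> ! m) = 0) \<or>
    (\<exists>k\<in>set \<phi>. k \<notin> snd ` mu \<and> w \<alpha> k \<noteq> 0 \<and>
       (\<forall>l\<in>set \<phi>. w \<alpha> l \<noteq> 0 \<longrightarrow> l = k \<or> precedes \<phi> k l))"
    by auto
  let ?k = "\<phi> ! n"
  have n: "n < length \<phi>" "?k \<in> set \<phi>" using Suc.prems by auto
  show ?case
  proof (cases "(\<forall>m<n. w \<alpha> (\<phi> ! m) = 0) \<and> w \<alpha> ?k \<noteq> 0")
    case False
    \<comment> \<open>Either the second alternative already holds, or the entry at \<open>?k\<close>
      is zero as well; the same \<open>\<alpha>\<close> serves.\<close>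
    then show ?thesis using IH by (auto intro!: exI[of _ \<alpha>] simp: less_Suc_eq)
  next
    case True
    have later: "l = ?k \<or> precedes \<phi> ?k l" if l: "l \<in> set \<phi>" "w \<alpha> l \<noteq> 0" for l
    proof -
      obtain m where m: "m < length \<phi>" "l = \<phi> ! m" using l(1) by (auto simp: in_set_conv_nth)
      then have "\<not> m < n" using True l(2) by auto
      then have "m = n \<or> n < m" by auto
      then show ?thesis using m unfolding precedes_def by blast
    qed
    show ?thesis
    proof (cases "?k \<in> snd ` mu")
      case False
      then show ?thesis using True later n(2) by (intro exI[of _ \<alpha>] disjI2 bexI[of _ ?k]) auto
    next
      case True': True
      then obtain i where arc: "(i, ?k) \<in> mu" by auto
      \<comment> \<open>Row \<open>i\<close> of \<open>arc_matr mu * B\<close> is row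
        \<open>?k\<close> of \<open>B\<close>; this multiple of it cancels the entry at
        \<open>?k\<close>.\<close>
      define c where "c = w \<alpha> ?k / B ?k ?k"
      define \<alpha>' where "\<alpha>' = (\<lambda>j. \<alpha> j - c * A i j)"
      have w': "w \<alpha>' l = w \<alpha> l - c * B ?k l" for l
      proof -
        have "(\<Sum>j\<in>set \<phi>. A i j * X j l) = mult_matr (set \<phi>) (arc_matr mu) B i l"
          using eq by (simp add: mult_matr_def[of _ A] fun_eq_iff)
        also have "\<dots> = B ?k l" by (rule mult_arc_matr_left[OF mu arc])
        finally show ?thesis
          by (simp add: w_def \<alpha>'_def left_diff_distrib sum_subtractf mult.assoc
              flip: sum_distrib_left)
      qed
      have "w \<alpha>' (\<phi> ! m) = 0" if m: "m < Suc n" for m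
      proof (cases "m = n")
        case True
        have "B ?k ?k \<noteq> 0" using B n by (auto simp: triangular_def)
        then show ?thesis using True by (simp add: w' c_def)
      next
        case False
        then have "m < n" using m by simp
        then have mn: "precedes \<phi> (\<phi> ! m) ?k" using n by (auto simp: precedes_def)
        then have "\<not> (?k = \<phi> ! m \<or> precedes \<phi> ?k (\<phi> ! m))"
          using precedes_trans[OF \<phi>] precedes_irrefl[OF \<phi>] by metis
        \<comment> \<open>Row \<open>?k\<close> of \<open>B\<close> is zero before
          \<open>?k\<close>, so the zeros already obtained persist.\<close>
        then have "B ?k (\<phi> ! m) = 0" using B by (auto simp: triangular_def)
        then show ?thesis using True \<open>m < n\<close> by (simp add: w')
      qed
      then show ?thesis by blast
    qed
  qed
qed

text \<open>Row reduction from the last letter to the first, by induction on the word: once the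
  later rows are reduced, \<open>reduce_row\<close> treats the row of \<open>x\<close>. If it
  becomes zero, \<open>mu\<close> stays. Otherwise its leading column \<open>k\<close> gives the new
  arc \<open>(x, k)\<close>, and the reduced row, suitably scaled, becomes row \<open>k\<close> of
  \<open>B\<close>. As \<open>k\<close> is no right endpoint of \<open>mu\<close>, the other rows of
  the product do not see that row.\<close>

lemma intertwined_arc_matr_exists:
  fixes X :: "('a, 'f::field) matr"
  assumes "distinct \<phi>" "\<And>i j. X i j \<noteq> 0 \<Longrightarrow> precedes \<phi> i j"
  shows "\<exists>mu\<in>set_partitions \<phi>. intertwined \<phi> X (arc_matr mu)"
  using assms
proof (induction \<phi> arbitrary: X)
  case Nil
  have "X = (\<lambda>_ _. 0)" using Nil.prems(2) by (auto simp: fun_eq_iff)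
  then show ?case
    by (auto simp: intertwined_def set_partitions_def triangular_def matr_on_def arc_matr_def
        mult_matr_def intro!: exI[of _ "\<lambda>_ _. 0"] exI[of _ "{}"])
next
  case (Cons x \<phi>)
  have x: "x \<notin> set \<phi>" "distinct \<phi>" using Cons.prems by auto
  define X' where "X' = (\<lambda>i j. if i = x then 0 else X i j)"
  have "precedes \<phi> i j" if "X' i j \<noteq> 0" for i j
    using Cons.prems(2)[of i j] that by (auto simp: X'_def precedes_Cons split: if_splits)
  then obtain mu A' B' where mu: "mu \<in> set_partitions \<phi>"
    and A': "triangular \<phi> A'" and B': "triangular \<phi> B'" and AB': "\<forall>i\<in>set \<phi>. A' i i = B' i i"
    and eq: "mult_matr (set \<phi>) A' X' = mult_matr (set \<phi>) (arc_matr mu) B'"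
    using Cons.IH[OF x(2), of X'] unfolding intertwined_def by blast
  have nx: "(i, x) \<notin> mu" "(x, i) \<notin> mu" for i using set_partitions_subset[OF mu] x by auto
  have A'0: "A' i j = 0" if "i \<notin> set \<phi> \<or> j \<notin> set \<phi>" for i j
    using A' that by (auto simp: triangular_def matr_on_def)
  have B'0: "B' i j = 0" if "i \<notin> set \<phi> \<or> j \<notin> set \<phi>" for i j
    using B' that by (auto simp: triangular_def matr_on_def)
  define w where "w = (\<lambda>\<alpha> l. X x l + (\<Sum>j\<in>set \<phi>. \<alpha> j * X' j l))"
  have w0: "w \<alpha> l = 0" if "l \<notin> set \<phi>" for \<alpha> l
  proof -
    have "X j l = 0" for j
      using that Cons.prems(2)[of j l] by (auto simp: precedes_Cons dest: precedes_in_set)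
    then show ?thesis by (simp add: w_def X'_def cong: if_cong)
  qed
  obtain \<alpha> where \<alpha>: "(\<forall>m<length \<phi>. w \<alpha> (\<phi> ! m) = 0) \<or>
    (\<exists>k\<in>set \<phi>. k \<notin> snd ` mu \<and> w \<alpha> k \<noteq> 0 \<and>
       (\<forall>l\<in>set \<phi>. w \<alpha> l \<noteq> 0 \<longrightarrow> l = k \<or> precedes \<phi> k l))"
    using reduce_row[OF x(2) B' mu eq le_refl, of "X x"] unfolding w_def by blast
  define A where "A = (\<lambda>s i j. if i = x then (if j = x then s else if j \<in> set \<phi> then s * \<alpha> j else 0)
    else A' i j)"
  have A: "triangular (x # \<phi>) (A s)" if "s \<noteq> 0" for s
    unfolding triangular_def
  proof (intro conjI ballI allI impI)
    show "matr_on (set (x # \<phi>)) (A s)" by (auto simp: matr_on_def A_def A'0)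
    show "A s i i \<noteq> 0" if "i \<in> set (x # \<phi>)" for i
      using that A' \<open>s \<noteq> 0\<close> x by (auto simp: A_def triangular_def)
    show "i = j \<or> precedes (x # \<phi>) i j" if "A s i j \<noteq> 0" for i j
      using that A' by (auto simp: A_def triangular_def precedes_Cons split: if_splits)
  qed
  have AX: "mult_matr (set (x # \<phi>)) (A s) X i l =
    (if i = x then s * w \<alpha> l else mult_matr (set \<phi>) (arc_matr mu) B' i l)" for s i l
  proof -
    have "mult_matr (set (x # \<phi>)) (A s) X i l = A s i x * X x l + (\<Sum>j\<in>set \<phi>. A s i j * X' j l)"
      using x(1) by (simp add: mult_matr_def) (auto simp: X'_def intro!: sum.cong)
    also have "\<dots> = (if i = x then s * w \<alpha> l else mult_matr (set \<phi>) A' X' i l)"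
      using x(1) A'0 by (auto simp: A_def w_def mult_matr_def distrib_left sum_distrib_left mult.assoc
          intro!: sum.cong)
    finally show ?thesis by (simp add: eq)
  qed
  have sub: "mu \<in> set_partitions (x # \<phi>)"
    using mu by (auto simp: set_partitions_def precedes_Cons)
  show ?case
  proof (cases "\<forall>l\<in>set \<phi>. w \<alpha> l = 0")
    case True
    then have w: "w \<alpha> l = 0" for l using w0 by blast
    \<comment> \<open>No arc of \<open>mu\<close> meets \<open>x\<close>, so row \<open>x\<close> of
      \<open>B\<close> does not enter the product; it only has to match the diagonal entry 1 of
      \<open>A 1\<close>.\<close>
    define B where "B = (\<lambda>i j. if i = x then (if j = x then 1 else 0) else B' i j)"
    have "triangular (x # \<phi>) B"
      using B' x by (auto simp: triangular_def matr_on_def B_def precedes_Cons split: if_splits)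
    moreover have "\<forall>i\<in>set (x # \<phi>). A 1 i i = B i i"
      using AB' by (auto simp: A_def B_def)
    moreover have "mult_matr (set (x # \<phi>)) (A 1) X = mult_matr (set (x # \<phi>)) (arc_matr mu) B"
    proof (intro ext)
      fix i l
      show "mult_matr (set (x # \<phi>)) (A 1) X i l = mult_matr (set (x # \<phi>)) (arc_matr mu) B i l"
        unfolding AX w using x(1) nx
        by (auto simp: mult_matr_def arc_matr_def B_def intro!: sum.cong)
    qed
    ultimately show ?thesis using A[of 1] sub unfolding intertwined_def by auto
  next
    case False
    then have "\<not> (\<forall>m<length \<phi>. w \<alpha> (\<phi> ! m) = 0)" by (auto simp: in_set_conv_nth)
    then obtain k where k: "k \<in> set \<phi>" "k \<notin> snd ` mu" "w \<alpha> k \<noteq> 0"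
      and later: "\<And>l. w \<alpha> l \<noteq> 0 \<Longrightarrow> l = k \<or> precedes \<phi> k l"
      using \<alpha> w0 by metis
    \<comment> \<open>This scaling gives \<open>B k k = s * w \<alpha> k = A' k k\<close>, as the
      equality of diagonals requires; at \<open>x\<close> both diagonals are
      \<open>s\<close>.\<close>
    define s where "s = A' k k / w \<alpha> k"
    have s: "s \<noteq> 0" using k A' by (auto simp: s_def triangular_def)
    define B where "B = (\<lambda>i j. if i = x then (if j = x then s else 0)
      else if i = k then s * w \<alpha> j else B' i j)"
    let ?mu = "insert (x, k) mu"
    have kx: "k \<noteq> x" using k x by auto
    have nk: "(a, k) \<notin> mu" for a using k(2) by force
    have mu': "?mu \<in> set_partitions (x # \<phi>)"
      using sub k(1) nx nk by (auto simp: set_partitions_def precedes_Cons)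
    have "triangular (x # \<phi>) B"
      unfolding triangular_def
    proof (intro conjI ballI allI impI)
      show "matr_on (set (x # \<phi>)) B" using k w0 B'0 by (auto simp: matr_on_def B_def)
      show "B i i \<noteq> 0" if "i \<in> set (x # \<phi>)" for i
        using that B' s k x by (auto simp: B_def triangular_def)
      show "i = j \<or> precedes (x # \<phi>) i j" if "B i j \<noteq> 0" for i j
        using that B' later[of j] by (auto simp: B_def triangular_def precedes_Cons split: if_splits)
    qed
    moreover have "\<forall>i\<in>set (x # \<phi>). A s i i = B i i"
      using AB' x k by (auto simp: A_def B_def s_def)
    moreover have "mult_matr (set (x # \<phi>)) (A s) X = mult_matr (set (x # \<phi>)) (arc_matr ?mu) B"
    proof (intro ext)
      fix i l
      show "mult_matr (set (x # \<phi>)) (A s) X i l = mult_matr (set (x # \<phi>)) (arc_matr ?mu) B i l"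
      proof (cases "i = x")
        case True
        then show ?thesis
          unfolding AX using mult_arc_matr_left[OF mu', of x k B l] kx by (simp add: B_def)
      next
        case False
        have "(\<Sum>j\<in>set \<phi>. (if (i, j) \<in> mu then 1 else 0) * B' j l) =
          (\<Sum>j\<in>set \<phi>. (if (i, j) \<in> ?mu then 1 else 0) * B j l)"
          using False x(1) k(2) by (intro sum.cong) (auto simp: B_def image_iff)
        then show ?thesis
          unfolding AX using False x(1) nx by (simp add: mult_matr_def arc_matr_def)
      qed
    qed
    ultimately show ?thesis using A[OF s] mu' unfolding intertwined_def by blast
  qed
qed

lemma minus_superclass_rep:
  "minus_matr (superclass_rep \<phi> mu) (one_matr (set \<phi>)) = (arc_matr mu :: ('a, 'f::field) matr)"
  by (simp add: minus_matr_def superclass_rep_def arc_matr_def fun_eq_iff)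

text \<open>The pair is turned around by \<open>intertwined_sym\<close>, into the form that row
  reduction produces.\<close>

lemma same_superclass_rep_iff:
  fixes u :: "('a, 'f::field) matr"
  assumes "distinct \<phi>" "mu \<in> set_partitions \<phi>" "u \<in> U \<phi>"
  shows "same_superclass \<phi> (superclass_rep \<phi> mu) u \<longleftrightarrow>
    intertwined \<phi> (minus_matr u (one_matr (set \<phi>))) (arc_matr mu)"
proof -
  have u: "matr_on (set \<phi>) u" using assms(3) by (simp add: U_def)
  have "matr_on (set \<phi>) (superclass_rep \<phi> mu :: ('a, 'f) matr)"
    using set_partitions_subset[OF assms(2)] matr_on_one[of "set \<phi>"]
    by (auto simp: matr_on_def superclass_rep_def)
  from same_superclass_iff[OF assms(1) this u] show ?thesis
    unfolding minus_superclass_rep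
    using intertwined_sym[OF assms(1) matr_on_arc_matr[OF assms(2)] matr_on_minus[OF u matr_on_one]]
      intertwined_sym[OF assms(1) matr_on_minus[OF u matr_on_one] matr_on_arc_matr[OF assms(2)]]
    by blast
qed

text \<open>Row reduction gives existence. The arc matrices of two solutions are intertwined through
  \<open>u - 1\<close>, so the solutions contain each other.\<close>

lemma superclass_rep_unique:
  fixes u :: "('a, 'f::field) matr"
  assumes \<phi>: "distinct \<phi>" and u: "u \<in> U \<phi>"
  shows "\<exists>!mu. mu \<in> set_partitions \<phi> \<and> same_superclass \<phi> (superclass_rep \<phi> mu) u"
proof -
  let ?X = "minus_matr u (one_matr (set \<phi>))"
  have on: "matr_on (set \<phi>) ?X"
    using u by (auto intro: matr_on_minus matr_on_one simp: U_def)
  have "precedes \<phi> i j" if "?X i j \<noteq> 0" for i j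
    using that u by (cases "i = j"; cases "i \<in> set \<phi>")
      (auto simp: U_def minus_matr_def one_matr_def diag_matr_def matr_on_def)
  then obtain mu where mu: "mu \<in> set_partitions \<phi>" "intertwined \<phi> ?X (arc_matr mu)"
    using intertwined_arc_matr_exists[OF \<phi>] by blast
  have sub: "nu \<subseteq> nu'" if nu: "nu \<in> set_partitions \<phi>" "intertwined \<phi> ?X (arc_matr nu)"
    "nu' \<in> set_partitions \<phi>" "intertwined \<phi> ?X (arc_matr nu')" for nu nu'
    using intertwined_trans[OF \<phi> intertwined_sym[OF \<phi> on matr_on_arc_matr[OF nu(1)] nu(2)] nu(4)]
    by (rule intertwined_arc_matr_subset[OF \<phi> nu(1) nu(3)])
  show ?thesis
  proof (rule ex1I[of _ mu])
    show "mu \<in> set_partitions \<phi> \<and> same_superclass \<phi> (superclass_rep \<phi> mu) u"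
      using mu same_superclass_rep_iff[OF \<phi> _ u] by blast
  next
    fix nu assume "nu \<in> set_partitions \<phi> \<and> same_superclass \<phi> (superclass_rep \<phi> nu) u"
    then have "nu \<in> set_partitions \<phi>" "intertwined \<phi> ?X (arc_matr nu)"
      using same_superclass_rep_iff[OF \<phi> _ u] by auto
    then show "nu = mu" using sub mu by blast
  qed
qed

text \<open>The index of the superclass of \<open>u\<close>; \<open>superclass_rep_unique\<close>
  justifies the definite description for distinct \<open>\<phi>\<close> and \<open>u\<close> in
  \<open>U \<phi>\<close>.\<close>

definition arc_type :: "'a list \<Rightarrow> ('a, 'f::field) matr \<Rightarrow> ('a \<times> 'a) set" where
  "arc_type \<phi> u = (THE mu. mu \<in> set_partitions \<phi> \<and> same_superclass \<phi> (superclass_rep \<phi> mu) u)"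

lemma arc_type_in_set_partitions:
  "distinct \<phi> \<Longrightarrow> u \<in> U \<phi> \<Longrightarrow> arc_type \<phi> u \<in> set_partitions \<phi>"
  unfolding arc_type_def by (drule (1) superclass_rep_unique, drule theI') blast

lemma same_superclass_rep_arc_type:
  assumes "distinct \<phi>" "u \<in> U \<phi>" "mu \<in> set_partitions \<phi>"
  shows "same_superclass \<phi> (superclass_rep \<phi> mu) u \<longleftrightarrow> mu = arc_type \<phi> u"
  using theI'[OF superclass_rep_unique[OF assms(1,2)], folded arc_type_def]
    superclass_rep_unique[OF assms(1,2)] assms(3) by blast

lemma arc_type_eqI:
  assumes "distinct \<phi>" "u \<in> U \<phi>" "mu \<in> set_partitions \<phi>"
    "intertwined \<phi> (minus_matr u (one_matr (set \<phi>))) (arc_matr mu)"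
  shows "arc_type \<phi> u = mu"
  using same_superclass_rep_arc_type[OF assms(1-3)] same_superclass_rep_iff[OF assms(1,3,2)] assms(4)
  by simp

section \<open>Block-diagonal matrices\<close>

lemma mult_block_matr:
  fixes u v u' v' :: "('a, 'f::field) matr"
  assumes "finite I" "finite J" "I \<inter> J = {}"
  shows "mult_matr (I \<union> J) (block_matr I J u v) (block_matr I J u' v') =
    block_matr I J (mult_matr I u u') (mult_matr J v v')"
proof (intro ext)
  fix i j
  have "mult_matr (I \<union> J) (block_matr I J u v) (block_matr I J u' v') i j =
    (\<Sum>k\<in>I. block_matr I J u v i k * block_matr I J u' v' k j) +
    (\<Sum>k\<in>J. block_matr I J u v i k * block_matr I J u' v' k j)"
    unfolding mult_matr_def by (rule sum.union_disjoint[OF assms])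
  moreover have "(\<Sum>k\<in>I. block_matr I J u v i k * block_matr I J u' v' k j) =
    (if i \<in> I \<and> j \<in> I then mult_matr I u u' i j else 0)"
    using assms(3) by (auto simp: mult_matr_def block_matr_def intro!: sum.cong sum.neutral)
  moreover have "(\<Sum>k\<in>J. block_matr I J u v i k * block_matr I J u' v' k j) =
    (if i \<in> J \<and> j \<in> J then mult_matr J v v' i j else 0)"
    using assms(3) by (auto simp: mult_matr_def block_matr_def intro!: sum.cong sum.neutral)
  ultimately show "mult_matr (I \<union> J) (block_matr I J u v) (block_matr I J u' v') i j =
    block_matr I J (mult_matr I u u') (mult_matr J v v') i j"
    using assms(3) by (auto simp: block_matr_def)
qed

lemma triangular_block_matr:
  assumes \<phi>: "set \<phi> = I \<union> J" "I \<inter> J = {}"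
    and "triangular (restrict_order \<phi> I) u" "triangular (restrict_order \<phi> J) v"
  shows "triangular \<phi> (block_matr I J u v)"
proof -
  have "set \<phi> \<inter> I = I" "set \<phi> \<inter> J = J" using \<phi> by auto
  then show ?thesis
    using assms by (auto simp: triangular_def block_matr_def matr_on_def precedes_restrict_order)
qed

lemma block_matr_in_U:
  assumes \<phi>: "distinct \<phi>" "set \<phi> = I \<union> J" "I \<inter> J = {}"
    and "u \<in> U (restrict_order \<phi> I)" "v \<in> U (restrict_order \<phi> J)"
  shows "block_matr I J u v \<in> U \<phi>"
  using assms triangular_block_matr[OF \<phi>(2,3), of u v]
  by (auto simp: U_iff block_matr_def)

text \<open>Block matrices multiply blockwise, so witnesses of \<open>intertwined\<close> for the
  two blocks assemble into witnesses for the whole. This is the rule for the coproduct of a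
  superclass indicator, phrased through arc types.\<close>

lemma arc_type_block_matr:
  fixes u v :: "('a, 'f::field) matr"
  assumes \<phi>: "distinct \<phi>" "set \<phi> = I \<union> J" "I \<inter> J = {}"
    and u: "u \<in> U (restrict_order \<phi> I)" and v: "v \<in> U (restrict_order \<phi> J)"
  shows "arc_type \<phi> (block_matr I J u v) =
    arc_type (restrict_order \<phi> I) u \<union> arc_type (restrict_order \<phi> J) v"
proof (rule arc_type_eqI[OF \<phi>(1) block_matr_in_U[OF assms]])
  let ?\<alpha> = "restrict_order \<phi> I" and ?\<beta> = "restrict_order \<phi> J"
  define mu where "mu = arc_type ?\<alpha> u"
  define nu where "nu = arc_type ?\<beta> v"
  have IJ: "set ?\<alpha> = I" "set ?\<beta> = J" and d: "distinct ?\<alpha>" "distinct ?\<beta>" using \<phi> by auto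
  have fin: "finite I" "finite J" using IJ by (metis finite_set)+
  have mu: "mu \<in> set_partitions ?\<alpha>" and nu: "nu \<in> set_partitions ?\<beta>"
    using arc_type_in_set_partitions d u v by (auto simp: mu_def nu_def)
  have mu_I: "mu \<subseteq> I \<times> I" and nu_J: "nu \<subseteq> J \<times> J"
    using set_partitions_subset[OF mu] set_partitions_subset[OF nu] IJ by auto
  show part: "arc_type ?\<alpha> u \<union> arc_type ?\<beta> v \<in> set_partitions \<phi>"
    unfolding mu_def[symmetric] nu_def[symmetric]
  proof -
    have "precedes \<phi> i j" if "(i, j) \<in> mu \<union> nu" for i j
      using that set_partitions_precedes[OF mu] set_partitions_precedes[OF nu]
      by (auto simp: precedes_restrict_order)
    moreover have "i = j \<longleftrightarrow> k = l" if "(i, l) \<in> mu \<union> nu" "(j, k) \<in> mu \<union> nu" for i j k l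
    proof (cases "(i, l) \<in> mu \<longleftrightarrow> (j, k) \<in> mu")
      case True
      then have "(i, l) \<in> mu \<and> (j, k) \<in> mu \<or> (i, l) \<in> nu \<and> (j, k) \<in> nu"
        using that by blast
      then show ?thesis
        using set_partitions_left_unique[OF mu] set_partitions_right_unique[OF mu]
          set_partitions_left_unique[OF nu] set_partitions_right_unique[OF nu] by blast
    next
      case False
      \<comment> \<open>An arc inside \<open>I\<close> and one inside \<open>J\<close> share no
        endpoint, so both sides of the equivalence are false.\<close>
      then have "(i, l) \<in> I \<times> I \<and> (j, k) \<in> J \<times> J \<or> (i, l) \<in> J \<times> J \<and> (j, k) \<in> I \<times> I"
        using that mu_I nu_J by blast
      then show ?thesis using \<phi>(3) by auto
    qed
    ultimately show "mu \<union> nu \<in> set_partitions \<phi>" unfolding set_partitions_def by blast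
  qed
  have "intertwined ?\<alpha> (minus_matr u (one_matr I)) (arc_matr mu)"
    using same_superclass_rep_iff[OF d(1) mu u] same_superclass_rep_arc_type[OF d(1) u mu] IJ
    by (simp add: mu_def)
  then obtain A B where AB: "triangular ?\<alpha> A" "triangular ?\<alpha> B" "\<forall>i\<in>I. A i i = B i i"
    "mult_matr I A (minus_matr u (one_matr I)) = mult_matr I (arc_matr mu) B"
    unfolding intertwined_def IJ by blast
  have "intertwined ?\<beta> (minus_matr v (one_matr J)) (arc_matr nu)"
    using same_superclass_rep_iff[OF d(2) nu v] same_superclass_rep_arc_type[OF d(2) v nu] IJ
    by (simp add: nu_def)
  then obtain A' B' where AB': "triangular ?\<beta> A'" "triangular ?\<beta> B'" "\<forall>i\<in>J. A' i i = B' i i"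
    "mult_matr J A' (minus_matr v (one_matr J)) = mult_matr J (arc_matr nu) B'"
    unfolding intertwined_def IJ by blast
  have one: "minus_matr (block_matr I J u v) (one_matr (set \<phi>)) =
    block_matr I J (minus_matr u (one_matr I)) (minus_matr v (one_matr J))"
    using \<phi>(2,3) by (auto simp: minus_matr_def block_matr_def one_matr_def diag_matr_def fun_eq_iff)
  have arcs: "arc_matr (mu \<union> nu) = (block_matr I J (arc_matr mu) (arc_matr nu) :: ('a, 'f) matr)"
    using mu_I nu_J \<phi>(3) by (auto simp: arc_matr_def block_matr_def fun_eq_iff)
  have "mult_matr (set \<phi>) (block_matr I J A A') (minus_matr (block_matr I J u v) (one_matr (set \<phi>))) =
    mult_matr (set \<phi>) (arc_matr (mu \<union> nu)) (block_matr I J B B')"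
    unfolding one arcs by (simp add: \<phi>(2) mult_block_matr[OF fin \<phi>(3)] AB(4) AB'(4))
  moreover have "\<forall>i\<in>set \<phi>. block_matr I J A A' i i = block_matr I J B B' i i"
    using AB(3) AB'(3) by (auto simp: block_matr_def)
  ultimately show "intertwined \<phi> (minus_matr (block_matr I J u v) (one_matr (set \<phi>)))
      (arc_matr (arc_type ?\<alpha> u \<union> arc_type ?\<beta> v))"
    unfolding intertwined_def mu_def[symmetric] nu_def[symmetric]
    using triangular_block_matr[OF \<phi>(2,3) AB(1) AB'(1)] triangular_block_matr[OF \<phi>(2,3) AB(2) AB'(2)]
    by blast
qed

section \<open>Coproducts of class functions\<close>

text \<open>
  For a class function with value \<open>g mu\<close> on the superclass \<open>mu\<close> of \<open>U \<phi>\<close>, this is its restriction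
  to the block-diagonal subgroup, as a function of the tuple of blocks.
\<close>

definition class_tensor ::
  "'a list \<Rightarrow> 'a set list \<Rightarrow> (('a \<times> 'a) set \<Rightarrow> complex) \<Rightarrow> ('a, 'f::field) tens" where
  "class_tensor \<phi> Js g = (\<lambda>xs.
     if list_all2 (\<lambda>J x. fst x = restrict_order \<phi> J \<and> snd x \<in> U (fst x)) Js xs
     then g (\<Union>x\<in>set xs. arc_type (fst x) (snd x)) else 0)"

text \<open>Among the orders on \<open>I \<union> J\<close> with the prescribed restrictions, only
  the restriction of \<open>\<phi>\<close> can lie in the support of \<open>class_tensor\<close>.
  The sum in the coproduct collapses to it, and \<open>arc_type_block_matr\<close> merges the arc
  types of the two blocks.\<close>

lemma coprod_first_class_tensor:
  assumes \<phi>: "distinct \<phi>" "I \<union> J \<subseteq> set \<phi>" and IJ: "I \<inter> J = {}"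
  shows "coprod_first I J (class_tensor \<phi> ((I \<union> J) # Js) g :: ('a, 'f::field) tens) =
    class_tensor \<phi> (I # J # Js) g"
proof
  fix xs :: "('a, 'f) point list"
  show "coprod_first I J (class_tensor \<phi> ((I \<union> J) # Js) g) xs = class_tensor \<phi> (I # J # Js) g xs"
  proof (cases "\<exists>\<alpha> u \<beta> v zs. xs = (\<alpha>, u) # (\<beta>, v) # zs")
    case False
    then have "xs = [] \<or> (\<exists>x. xs = [x])" by (cases xs; cases "tl xs") auto
    then show ?thesis by (auto simp: coprod_first_def class_tensor_def)
  next
    case True
    then obtain \<alpha> u \<beta> v zs where xs: "xs = (\<alpha>, u) # (\<beta>, v) # zs" by blast
    show ?thesis
    proof (cases "u \<in> U \<alpha> \<and> v \<in> U \<beta>")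
      case False
      then show ?thesis by (auto simp: xs coprod_first_def class_tensor_def coprod_def)
    next
      case True
      define \<rho> where "\<rho> = restrict_order \<phi> (I \<union> J)"
      define S where "S = {\<psi> \<in> permutations_of_set (I \<union> J).
        restrict_order \<psi> I = \<alpha> \<and> restrict_order \<psi> J = \<beta>}"
      have \<rho>: "distinct \<rho>" "set \<rho> = I \<union> J" using \<phi> by (auto simp: \<rho>_def)
      have \<rho>IJ: "restrict_order \<rho> I = restrict_order \<phi> I" "restrict_order \<rho> J = restrict_order \<phi> J"
        unfolding \<rho>_def restrict_order_restrict_order by (rule arg_cong[of _ _ "restrict_order \<phi>"], blast)+
      have "finite (I \<union> J)" using \<phi>(2) finite_subset by auto
      then have "finite S" by (simp add: S_def)
      have \<rho>S: "\<rho> \<in> S \<longleftrightarrow> restrict_order \<phi> I = \<alpha> \<and> restrict_order \<phi> J = \<beta>"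
        using \<rho> by (simp add: S_def \<rho>IJ permutations_of_set_def)
      let ?F = "\<lambda>\<psi>. class_tensor \<phi> ((I \<union> J) # Js) g ((\<psi>, block_matr I J u v) # zs)"
      have "coprod_first I J (class_tensor \<phi> ((I \<union> J) # Js) g) xs = (\<Sum>\<psi>\<in>S. ?F \<psi>)"
        using True by (simp add: xs coprod_first_def coprod_def S_def)
      also have "\<dots> = (\<Sum>\<psi>\<in>S. if \<psi> = \<rho> then ?F \<rho> else 0)"
        by (rule sum.cong) (auto simp: class_tensor_def \<rho>_def)
      also have "\<dots> = (if \<rho> \<in> S then ?F \<rho> else 0)" using \<open>finite S\<close> by simp
      also have "\<dots> = class_tensor \<phi> (I # J # Js) g xs"
      proof (cases "\<rho> \<in> S")
        case False
        then show ?thesis by (auto simp: \<rho>S class_tensor_def xs)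
      next
        case S: True
        then have \<alpha>\<beta>: "\<alpha> = restrict_order \<phi> I" "\<beta> = restrict_order \<phi> J" by (auto simp: \<rho>S)
        have uv: "u \<in> U (restrict_order \<rho> I)" "v \<in> U (restrict_order \<rho> J)"
          using True by (simp_all add: \<alpha>\<beta> \<rho>IJ)
        show ?thesis
          using S True block_matr_in_U[OF \<rho> IJ uv] arc_type_block_matr[OF \<rho> IJ uv]
          by (simp add: class_tensor_def xs \<alpha>\<beta> \<rho>IJ \<rho>_def[symmetric] Un_assoc)
      qed
      finally show ?thesis .
    qed
  qed
qed

text \<open>\<open>iter_coprod\<close> joins \<open>J\<close> to \<open>I\<close> before recursing,
  so the induction runs over all \<open>I\<close>: the later blocks are split off first, then
  \<open>J\<close>.\<close>

lemma iter_coprod_class_tensor: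
  assumes "distinct \<phi>" "\<Union> (set (I # Js)) \<subseteq> set \<phi>" "sorted_wrt (\<lambda>A B. A \<inter> B = {}) (I # Js)"
  shows "iter_coprod I Js (class_tensor \<phi> [\<Union> (set (I # Js))] g :: ('a, 'f::field) tens) =
    class_tensor \<phi> (I # Js) g"
  using assms(2,3)
proof (induction Js arbitrary: I)
  case Nil
  then show ?case by simp
next
  case (Cons J Js)
  have "iter_coprod (I \<union> J) Js (class_tensor \<phi> [\<Union> (set ((I \<union> J) # Js))] g :: ('a, 'f) tens) =
    class_tensor \<phi> ((I \<union> J) # Js) g"
    using Cons.prems by (intro Cons.IH) auto
  then show ?case
    using Cons.prems coprod_first_class_tensor[OF assms(1), of I J Js g] by (simp add: Un_assoc)
qed

text \<open>Within the sum, \<open>kappa \<phi> mu\<close> is nonzero at \<open>x\<close> only for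
  \<open>mu = arc_type \<phi> (snd x)\<close>, so at most one summand survives.\<close>

lemma P_elem_eq:
  fixes x :: "('a, 'f::field) point"
  assumes \<phi>: "distinct \<phi>"
  shows "P_elem q \<phi> lam x = (if fst x = \<phi> \<and> snd x \<in> U \<phi> \<and> lam \<subseteq> arc_type \<phi> (snd x)
    then 1 / of_nat q ^ nst \<phi> lam (arc_type \<phi> (snd x) - lam) else 0)"
proof (cases "fst x = \<phi> \<and> snd x \<in> U \<phi>")
  case False
  then show ?thesis by (auto simp: P_elem_def kappa_def split: prod.splits intro!: sum.neutral)
next
  case True
  let ?mu = "arc_type \<phi> (snd x)"
  let ?S = "{mu \<in> set_partitions \<phi>. lam \<subseteq> mu}"
  have mu: "?mu \<in> set_partitions \<phi>" using arc_type_in_set_partitions[OF \<phi>] True by blast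
  have kappa: "kappa \<phi> mu x = (if mu = ?mu then 1 else 0)" if "mu \<in> set_partitions \<phi>" for mu
    using True same_superclass_rep_arc_type[OF \<phi> _ that, of "snd x"]
    by (cases x) (auto simp: kappa_def)
  have "P_elem q \<phi> lam x =
    (\<Sum>mu\<in>?S. if mu = ?mu then 1 / of_nat q ^ nst \<phi> lam (?mu - lam) else 0)"
    unfolding P_elem_def by (rule sum.cong) (auto simp: kappa)
  then show ?thesis using True mu by simp
qed

lemma restrict_order_full: "set \<phi> \<subseteq> J \<Longrightarrow> restrict_order \<phi> J = \<phi>"
  by (auto simp: restrict_order_def intro: filter_True)

lemma tensor_P_elem:
  assumes "distinct \<phi>"
  shows "tensor [P_elem q \<phi> lam :: ('a, 'f::field) func] = class_tensor \<phi> [set \<phi>]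
    (\<lambda>nu. if lam \<subseteq> nu then 1 / of_nat q ^ nst \<phi> lam (nu - lam) else 0)"
proof
  fix xs :: "('a, 'f) point list"
  show "tensor [P_elem q \<phi> lam] xs = class_tensor \<phi> [set \<phi>]
    (\<lambda>nu. if lam \<subseteq> nu then 1 / of_nat q ^ nst \<phi> lam (nu - lam) else 0) xs"
    by (cases xs; cases "tl xs")
      (auto simp: tensor_def class_tensor_def P_elem_eq[OF assms] restrict_order_full)
qed

section \<open>Nestings\<close>

text \<open>Nestings are counted by their inner arc: \<open>N e\<close> collects the arcs of
  \<open>lam\<close> around \<open>e\<close>.\<close>

lemma nst_eq_sum:
  assumes "finite lam" "finite mu"
  shows "nst \<phi> lam mu = (\<Sum>e\<in>mu. nst \<phi> lam {e})"
proof -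
  define N where "N = (\<lambda>e. {p \<in> lam. precedes \<phi> (fst p) (fst e) \<and> precedes \<phi> (fst e) (snd e) \<and>
    precedes \<phi> (snd e) (snd p)})"
  have N: "nst \<phi> lam mu = (\<Sum>e\<in>mu. card (N e))" if "finite mu" for mu
  proof -
    have "{((i, l), (j, k)) | i l j k. (i, l) \<in> lam \<and> (j, k) \<in> mu \<and>
      precedes \<phi> i j \<and> precedes \<phi> j k \<and> precedes \<phi> k l} = (\<lambda>(e, p). (p, e)) ` Sigma mu N"
      by (fastforce simp: N_def image_iff)
    moreover have "inj_on (\<lambda>(e, p). (p, e)) (Sigma mu N)" by (auto simp: inj_on_def)
    moreover have "\<forall>e\<in>mu. finite (N e)" using assms(1) by (simp add: N_def)
    ultimately show ?thesis unfolding nst_def using that by (simp add: card_image)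
  qed
  show ?thesis using N[OF assms(2)] by (simp add: N)
qed

text \<open>This factors the weight over inner arcs, as needed for the products in
  \<open>sum_Pow_prod_diff\<close>.\<close>

lemma inverse_power_nst:
  assumes "finite lam" "finite mu"
  shows "1 / (of_nat q :: 'c::field) ^ nst \<phi> lam mu = (\<Prod>e\<in>mu. 1 / of_nat q ^ nst \<phi> lam {e})"
  unfolding nst_eq_sum[OF assms] by (simp add: power_sum prod_dividef)

lemma nst_restrict_order:
  assumes "lam \<subseteq> J \<times> J" "mu \<subseteq> J \<times> J"
  shows "nst (restrict_order \<phi> J) lam mu = nst \<phi> lam mu"
  unfolding nst_def precedes_restrict_order using assms
  by (intro arg_cong[of _ _ card]) blast

text \<open>An arc around \<open>e\<close> has to start before \<open>e\<close> does.\<close>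

lemma nst_insert:
  assumes "\<not> precedes \<phi> (fst f) (fst e)"
  shows "nst \<phi> (arcs_on (insert f mu) B) {e} = nst \<phi> (arcs_on mu B) {e}"
  unfolding nst_def arcs_on_def using assms by (intro arg_cong[of _ _ card]) auto

text \<open>
  Peeling off an element \<open>f\<close> of minimal rank, which influences no weight \<open>y e\<close> with \<open>e \<noteq> f\<close>,
  contributes the factor \<open>(x f - y f T) + y f T = x f\<close>.
\<close>

lemma sum_Pow_prod_diff:
  fixes x :: "'e \<Rightarrow> 'c::comm_ring_1" and y :: "'e \<Rightarrow> 'e set \<Rightarrow> 'c" and rank :: "'e \<Rightarrow> nat"
  assumes "finite S"
    and "\<And>e f T. e \<in> S \<Longrightarrow> f \<in> S \<Longrightarrow> T \<subseteq> S \<Longrightarrow> rank e \<le> rank f \<Longrightarrow> y e (insert f T) = y e T"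
  shows "(\<Sum>T\<in>Pow S. (\<Prod>e\<in>T. x e - y e T) * (\<Prod>e\<in>S - T. y e T)) = (\<Prod>e\<in>S. x e)"
  using assms
proof (induction S rule: finite_ranking_induct[where f = rank])
  case empty
  then show ?case by simp
next
  case (insert f S)
  show ?case
  \<comment> \<open>The rule \<open>finite_ranking_induct\<close> does not exclude that
    \<open>f\<close> already lies in \<open>S\<close>; the sum is then unchanged.\<close>
  proof (cases "f \<in> S")
    case True
    then show ?thesis using insert.IH insert.prems by (simp add: insert_absorb)
  next
    case False
    let ?g = "\<lambda>S T. (\<Prod>e\<in>T. x e - y e T) * (\<Prod>e\<in>S - T. y e T)"
    have fin: "finite T" if "T \<subseteq> S" for T using that insert.hyps finite_subset by blast
    \<comment> \<open>The induction inserts \<open>f\<close> with maximal rank, at least that of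
      every element of \<open>S\<close>, so the hypothesis on \<open>y\<close> covers all
      \<open>e\<close> in \<open>insert f S\<close>, including \<open>f\<close> itself.\<close>
    have inv: "y e (insert f T) = y e T" if "e \<in> insert f S" "T \<subseteq> S" for e T
      using insert.hyps(2) that by (intro insert.prems) auto
    have without: "?g (insert f S) T = y f T * ?g S T" if T: "T \<subseteq> S" for T
    proof -
      have "insert f S - T = insert f (S - T)" using False T by auto
      then show ?thesis using False insert.hyps(1) by (simp add: mult_ac)
    qed
    have with_f: "?g (insert f S) (insert f T) = (x f - y f T) * ?g S T" if T: "T \<subseteq> S" for T
    proof -
      have "insert f S - insert f T = S - T" using False by auto
      moreover have "(\<Prod>e\<in>insert f T. x e - y e (insert f T)) = (\<Prod>e\<in>insert f T. x e - y e T)"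
        using T by (intro prod.cong refl) (subst inv, auto)
      moreover have "\<dots> = (x f - y f T) * (\<Prod>e\<in>T. x e - y e T)"
        using False T fin[OF T] by (intro prod.insert) auto
      moreover have "(\<Prod>e\<in>S - T. y e (insert f T)) = (\<Prod>e\<in>S - T. y e T)"
        using T by (intro prod.cong) (auto simp: inv)
      ultimately show ?thesis by (simp add: mult_ac)
    qed
    have both: "?g (insert f S) T + ?g (insert f S) (insert f T) = x f * ?g S T" if "T \<subseteq> S" for T
      unfolding without[OF that] with_f[OF that] by (simp add: algebra_simps)
    have inj: "inj_on (insert f) (Pow S)"
      using False by (auto simp: inj_on_def)
    have "(\<Sum>T\<in>Pow (insert f S). ?g (insert f S) T) =
      (\<Sum>T\<in>Pow S. ?g (insert f S) T) + (\<Sum>T\<in>insert f ` Pow S. ?g (insert f S) T)"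
      unfolding Pow_insert using False insert.hyps(1) by (intro sum.union_disjoint) auto
    also have "\<dots> = (\<Sum>T\<in>Pow S. ?g (insert f S) T + ?g (insert f S) (insert f T))"
      by (simp add: sum.reindex[OF inj] sum.distrib)
    also have "\<dots> = (\<Sum>T\<in>Pow S. x f * ?g S T)"
      by (intro sum.cong refl both) simp
    also have "\<dots> = x f * (\<Prod>e\<in>S. x e)"
      unfolding sum_distrib_left[symmetric]
      by (subst insert.IH, rule insert.prems) auto
    finally show ?thesis using False insert.hyps(1) by simp
  qed
qed

section \<open>Arc sets without arcs between blocks\<close>

definition splits :: "'a set list \<Rightarrow> ('a \<times> 'a) set \<Rightarrow> bool" where
  "splits Js mu \<longleftrightarrow> mu = (\<Union>J\<in>set Js. arcs_on mu J)"

text \<open>Positions \<open>k\<close> replace the sets \<open>J\<close> because tensor factors and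
  the products in \<open>coeff_a\<close> are indexed by position.\<close>

lemma splits_iff: "splits Js mu \<longleftrightarrow> (\<forall>e\<in>mu. \<exists>k<length Js. e \<in> Js ! k \<times> Js ! k)"
proof -
  have arcs: "(\<Union>J\<in>set Js. arcs_on mu J) = {e \<in> mu. \<exists>J\<in>set Js. e \<in> J \<times> J}"
    by (auto simp: arcs_on_def)
  have "splits Js mu \<longleftrightarrow> (\<forall>e\<in>mu. \<exists>J\<in>set Js. e \<in> J \<times> J)"
    unfolding splits_def arcs by auto
  moreover have "(\<exists>J\<in>set Js. P J) \<longleftrightarrow> (\<exists>k<length Js. P (Js ! k))" for P
    by (metis in_set_conv_nth)
  ultimately show ?thesis by (simp only:)
qed

lemma splits_mono: "splits Js nu \<Longrightarrow> mu \<subseteq> nu \<Longrightarrow> splits Js mu"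
  unfolding splits_iff by blast

lemma arcs_on_subset_splits:
  assumes "splits Js mu"
  shows "(\<forall>k<length Js. arcs_on mu (Js ! k) \<subseteq> arcs_on nu (Js ! k)) \<longleftrightarrow> mu \<subseteq> nu"
proof
  assume sub: "\<forall>k<length Js. arcs_on mu (Js ! k) \<subseteq> arcs_on nu (Js ! k)"
  show "mu \<subseteq> nu"
  proof
    fix e assume "e \<in> mu"
    then obtain k where "k < length Js" "e \<in> arcs_on mu (Js ! k)"
      using assms by (auto simp: splits_iff arcs_on_def)
    then have "e \<in> arcs_on nu (Js ! k)" using sub by blast
    then show "e \<in> nu" by (auto simp: arcs_on_def)
  qed
qed (auto simp: arcs_on_def)

lemma arcs_on_subset: "arcs_on mu J \<subseteq> mu" "arcs_on mu J \<subseteq> J \<times> J"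
  by (auto simp: arcs_on_def)

lemma arcs_on_Diff: "arcs_on (mu - nu) J = arcs_on mu J - arcs_on nu J"
  "arcs_on mu J - nu = arcs_on (mu - nu) J"
  by (auto simp: arcs_on_def)

text \<open>For disjoint blocks this is the one block containing \<open>i\<close>. It lets the
  weight of an arc be written without the position of its block.\<close>

definition block_of :: "'a set list \<Rightarrow> 'a \<Rightarrow> 'a set" where
  "block_of Js i = \<Union> {J \<in> set Js. i \<in> J}"

context
  fixes Js :: "'a set list"
  assumes disj: "\<And>a b. a < length Js \<Longrightarrow> b < length Js \<Longrightarrow> a \<noteq> b \<Longrightarrow> Js ! a \<inter> Js ! b = {}"
begin

lemma block_of_eq: "k < length Js \<Longrightarrow> i \<in> Js ! k \<Longrightarrow> block_of Js i = Js ! k"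
proof -
  assume k: "k < length Js" "i \<in> Js ! k"
  then have "{J \<in> set Js. i \<in> J} = {Js ! k}"
    using disj by (auto simp: in_set_conv_nth)
  then show ?thesis by (simp add: block_of_def)
qed

text \<open>The arc sets of different blocks are disjoint and exhaust \<open>mu\<close>; this
  flattens double products such as the one in \<open>coeff_a\<close>.\<close>

lemma prod_blocks:
  fixes h :: "'a \<times> 'a \<Rightarrow> 'c::comm_monoid_mult"
  assumes "finite mu" "splits Js mu"
  shows "(\<Prod>k<length Js. \<Prod>e\<in>arcs_on mu (Js ! k). h e) = (\<Prod>e\<in>mu. h e)"
proof -
  have mu: "mu = (\<Union>k<length Js. arcs_on mu (Js ! k))"
    using assms(2) unfolding splits_iff arcs_on_def by fastforce
  have "(\<Prod>e\<in>(\<Union>k<length Js. arcs_on mu (Js ! k)). h e) =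
    (\<Prod>k<length Js. \<Prod>e\<in>arcs_on mu (Js ! k). h e)"
  proof (rule prod.UNION_disjoint)
    show "\<forall>k\<in>{..<length Js}. finite (arcs_on mu (Js ! k))"
      using finite_subset[OF arcs_on_subset(1) assms(1)] by blast
    show "\<forall>a\<in>{..<length Js}. \<forall>b\<in>{..<length Js}. a \<noteq> b \<longrightarrow>
      arcs_on mu (Js ! a) \<inter> arcs_on mu (Js ! b) = {}"
      using disj by (force simp: arcs_on_def)
  qed simp
  then show ?thesis using mu by simp
qed

text \<open>The equality of values at a tuple with combined arc type \<open>nu\<close>. Coefficients
  and tensor factors both become products over single arcs, and the substitution
  \<open>mu = lam \<union> T\<close> leads to \<open>sum_Pow_prod_diff\<close>.\<close>

lemma sum_coeff_a:
  assumes \<phi>: "distinct \<phi>" and nu: "finite nu" "splits Js nu" and lam: "lam \<subseteq> nu"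
  shows "(\<Sum>mu | lam \<subseteq> mu \<and> mu \<subseteq> nu. coeff_a q \<phi> Js lam mu *
      (\<Prod>k<length Js. 1 / of_nat q ^ nst \<phi> (arcs_on mu (Js ! k))
         (arcs_on nu (Js ! k) - arcs_on mu (Js ! k)))) =
    1 / of_nat q ^ nst \<phi> lam (nu - lam)"
proof -
  define x :: "'a \<times> 'a \<Rightarrow> complex" where "x = (\<lambda>e. 1 / of_nat q ^ nst \<phi> lam {e})"
  \<comment> \<open>The left endpoint of an arc inside a block determines that block.\<close>
  define y :: "'a \<times> 'a \<Rightarrow> ('a \<times> 'a) set \<Rightarrow> complex" where
    "y = (\<lambda>e mu. 1 / of_nat q ^ nst \<phi> (arcs_on mu (block_of Js (fst e))) {e})"
  \<comment> \<open>An arc around \<open>e\<close> starts earlier and so has smaller rank; inserting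
    an arc of rank at least that of \<open>e\<close> leaves the weight of \<open>e\<close>
    unchanged.\<close>
  define rank where "rank = (\<lambda>e :: 'a \<times> 'a. card {a. precedes \<phi> a (fst e)})"
  have fin: "finite mu" if "mu \<subseteq> nu" for mu using that nu(1) finite_subset by blast
  have y: "y e mu = 1 / of_nat q ^ nst \<phi> (arcs_on mu (Js ! k)) {e}"
    if "k < length Js" "e \<in> arcs_on M (Js ! k)" for e mu M k
    using that block_of_eq[of k "fst e"] by (auto simp: y_def arcs_on_def)
  have coeff: "coeff_a q \<phi> Js lam mu = (\<Prod>e\<in>mu - lam. x e - y e mu)" if mu: "mu \<subseteq> nu" for mu
  proof -
    have "mu - lam \<subseteq> nu" using mu by blast
    from prod_blocks[OF fin[OF this] splits_mono[OF nu(2) this], of "\<lambda>e. x e - y e mu", symmetric]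
    show ?thesis
      unfolding coeff_a_def arcs_on_Diff(2) x_def
      by (simp, intro prod.cong refl) (auto simp: y)
  qed
  have rest: "(\<Prod>k<length Js. 1 / of_nat q ^ nst \<phi> (arcs_on mu (Js ! k))
       (arcs_on nu (Js ! k) - arcs_on mu (Js ! k))) = (\<Prod>e\<in>nu - mu. y e mu)"
    if mu: "mu \<subseteq> nu" for mu
  proof -
    have "nu - mu \<subseteq> nu" by blast
    from prod_blocks[OF fin[OF this] splits_mono[OF nu(2) this], of "\<lambda>e. y e mu", symmetric]
    have "(\<Prod>e\<in>nu - mu. y e mu) = (\<Prod>k<length Js. \<Prod>e\<in>arcs_on (nu - mu) (Js ! k). y e mu)" .
    also have "\<dots> = (\<Prod>k<length Js. 1 / of_nat q ^ nst \<phi> (arcs_on mu (Js ! k))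
       (arcs_on (nu - mu) (Js ! k)))"
    proof (rule prod.cong[OF refl])
      fix k assume k: "k \<in> {..<length Js}"
      have "finite (arcs_on mu (Js ! k))" "finite (arcs_on (nu - mu) (Js ! k))"
        using finite_subset[OF arcs_on_subset(1)] fin mu nu(1) by blast+
      then show "(\<Prod>e\<in>arcs_on (nu - mu) (Js ! k). y e mu) =
        1 / of_nat q ^ nst \<phi> (arcs_on mu (Js ! k)) (arcs_on (nu - mu) (Js ! k))"
        using k by (subst inverse_power_nst) (auto simp: y intro!: prod.cong)
    qed
    finally show ?thesis by (simp add: arcs_on_Diff(1))
  qed
  have indep: "y e (lam \<union> insert f T) = y e (lam \<union> T)" if "rank e \<le> rank f" for e f T
  proof -
    have "\<not> precedes \<phi> (fst f) (fst e)"
    proof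
      assume fe: "precedes \<phi> (fst f) (fst e)"
      have "{a. precedes \<phi> a (fst f)} \<subset> {a. precedes \<phi> a (fst e)}"
        using fe precedes_trans[OF \<phi> _ fe] precedes_irrefl[OF \<phi>, of "fst f"] by blast
      moreover have "finite {a. precedes \<phi> a (fst e)}"
        by (rule finite_subset[of _ "set \<phi>"]) (auto dest: precedes_in_set)
      ultimately have "rank f < rank e" unfolding rank_def by (rule psubset_card_mono[rotated])
      then show False using that by simp
    qed
    then show ?thesis by (simp add: y_def nst_insert)
  qed
  have "(\<Sum>mu | lam \<subseteq> mu \<and> mu \<subseteq> nu. coeff_a q \<phi> Js lam mu *
      (\<Prod>k<length Js. 1 / of_nat q ^ nst \<phi> (arcs_on mu (Js ! k))
         (arcs_on nu (Js ! k) - arcs_on mu (Js ! k)))) =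
    (\<Sum>mu | lam \<subseteq> mu \<and> mu \<subseteq> nu. (\<Prod>e\<in>mu - lam. x e - y e mu) * (\<Prod>e\<in>nu - mu. y e mu))"
    by (intro sum.cong refl) (simp add: coeff rest)
  also have "\<dots> = (\<Sum>T\<in>Pow (nu - lam). (\<Prod>e\<in>T. x e - y e (lam \<union> T)) *
      (\<Prod>e\<in>nu - lam - T. y e (lam \<union> T)))"
  proof (rule sum.reindex_bij_witness[of _ "\<lambda>T. lam \<union> T" "\<lambda>mu. mu - lam"])
    fix mu assume "mu \<in> {mu. lam \<subseteq> mu \<and> mu \<subseteq> nu}"
    then have "lam \<union> (mu - lam) = mu" "nu - lam - (mu - lam) = nu - mu" by auto
    then show "(\<Prod>e\<in>mu - lam. x e - y e (lam \<union> (mu - lam))) *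
        (\<Prod>e\<in>nu - lam - (mu - lam). y e (lam \<union> (mu - lam))) =
      (\<Prod>e\<in>mu - lam. x e - y e mu) * (\<Prod>e\<in>nu - mu. y e mu)"
      by simp
  qed (use lam in auto)
  also have "\<dots> = (\<Prod>e\<in>nu - lam. x e)"
    using nu(1) indep by (intro sum_Pow_prod_diff[where rank = rank]) auto
  also have "\<dots> = 1 / of_nat q ^ nst \<phi> lam (nu - lam)"
    unfolding x_def using fin[OF lam] nu(1) by (subst inverse_power_nst) auto
  finally show ?thesis .
qed

text \<open>Arcs of different blocks share no endpoint, so set partitions of the blocks glue to one
  of the whole order, from which each can be recovered.\<close>

lemma set_partitions_Union:
  assumes "\<And>k. k < length Js \<Longrightarrow> nus k \<in> set_partitions (restrict_order \<phi> (Js ! k))"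
  defines "nu \<equiv> \<Union>k<length Js. nus k"
  shows "nu \<in> set_partitions \<phi>" "splits Js nu"
    "\<And>k. k < length Js \<Longrightarrow> arcs_on nu (Js ! k) = nus k"
proof -
  have sub: "nus k \<subseteq> Js ! k \<times> Js ! k" if "k < length Js" for k
    using set_partitions_subset[OF assms(1)[OF that]] by auto
  then show "splits Js nu" unfolding splits_iff nu_def by blast
  show on: "arcs_on nu (Js ! k) = nus k" if k: "k < length Js" for k
  proof
    show "nus k \<subseteq> arcs_on nu (Js ! k)" using sub[OF k] k by (auto simp: nu_def arcs_on_def)
    show "arcs_on nu (Js ! k) \<subseteq> nus k"
    proof
      fix e assume "e \<in> arcs_on nu (Js ! k)"
      then obtain k' where "k' < length Js" "e \<in> nus k'" "fst e \<in> Js ! k"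
        by (auto simp: nu_def arcs_on_def)
      moreover from this have "k' = k" using sub[of k'] disj[OF _ k] by fastforce
      ultimately show "e \<in> nus k" by simp
    qed
  qed
  have "precedes \<phi> i j" if "(i, j) \<in> nu" for i j
    using that set_partitions_precedes[OF assms(1)] by (auto simp: nu_def precedes_restrict_order)
  moreover have "i = j \<longleftrightarrow> k = l" if arcs: "(i, l) \<in> nu" "(j, k) \<in> nu" for i j k l
  proof -
    obtain a b where ab: "a < length Js" "b < length Js" "(i, l) \<in> nus a" "(j, k) \<in> nus b"
      using arcs by (auto simp: nu_def)
    show ?thesis
    proof (cases "a = b")
      case True
      then show ?thesis
        using ab set_partitions_left_unique[OF assms(1)] set_partitions_right_unique[OF assms(1)]
        by blast
    next
      case False
      then show ?thesis using disj[OF ab(1,2)] sub[OF ab(1)] sub[OF ab(2)] ab(3,4) by auto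
    qed
  qed
  ultimately show "nu \<in> set_partitions \<phi>" unfolding set_partitions_def by blast
qed

text \<open>Both sides vanish at tuples with a wrong order, a matrix outside its group or a wrong
  length. At all other tuples the claim is \<open>sum_coeff_a\<close> for the union
  \<open>nu\<close> of the arc types.\<close>

lemma sum_tensor_P_elem:
  assumes \<phi>: "distinct \<phi>" and Js: "\<Union> (set Js) = set \<phi>"
  shows "(\<lambda>xs. \<Sum>mu | mu \<in> set_partitions \<phi> \<and> lam \<subseteq> mu \<and> splits Js mu.
       coeff_a q \<phi> Js lam mu *
       tensor (map (\<lambda>J. P_elem q (restrict_order \<phi> J) (arcs_on mu J)) Js) xs) =
    (class_tensor \<phi> Js
      (\<lambda>nu. if lam \<subseteq> nu then 1 / of_nat q ^ nst \<phi> lam (nu - lam) else 0) :: ('a, 'f::field) tens)"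
proof
  fix xs :: "('a, 'f) point list"
  let ?ok = "list_all2 (\<lambda>J x. fst x = restrict_order \<phi> J \<and> snd x \<in> U (fst x)) Js xs"
  let ?S = "{mu. mu \<in> set_partitions \<phi> \<and> lam \<subseteq> mu \<and> splits Js mu}"
  let ?P = "\<lambda>mu. tensor (map (\<lambda>J. P_elem q (restrict_order \<phi> J) (arcs_on mu J)) Js) xs"
  let ?g = "\<lambda>nu. if lam \<subseteq> nu then 1 / of_nat q ^ nst \<phi> lam (nu - lam) else 0 :: complex"
  have P: "?P mu = (if length xs = length Js then \<Prod>k<length Js.
      P_elem q (restrict_order \<phi> (Js ! k)) (arcs_on mu (Js ! k)) (xs ! k) else 0)" for mu
    by (simp add: tensor_def)
  show "(\<Sum>mu\<in>?S. coeff_a q \<phi> Js lam mu * ?P mu) = class_tensor \<phi> Js ?g xs"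
  proof (cases ?ok)
    case False
    have "?P mu = 0" for mu
    proof (cases "length xs = length Js")
      case True
      then obtain k where "k < length Js"
        "\<not> (fst (xs ! k) = restrict_order \<phi> (Js ! k) \<and> snd (xs ! k) \<in> U (fst (xs ! k)))"
        using False by (auto simp: list_all2_conv_all_nth)
      then show ?thesis unfolding P
        by (auto simp: P_elem_eq \<phi> intro!: prod_zero bexI[of _ k])
    qed (simp add: P)
    then show ?thesis using False by (simp add: class_tensor_def)
  next
    case True
    then have ok: "fst (xs ! k) = restrict_order \<phi> (Js ! k)" "snd (xs ! k) \<in> U (fst (xs ! k))"
      if "k < length Js" for k
      using that by (auto simp: list_all2_conv_all_nth)
    have len: "length xs = length Js" using True by (simp add: list_all2_conv_all_nth)
    define nus where "nus = (\<lambda>k. arc_type (fst (xs ! k)) (snd (xs ! k)))"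
    define nu where "nu = (\<Union>k<length Js. nus k)"
    have nus: "nus k \<in> set_partitions (restrict_order \<phi> (Js ! k))" if "k < length Js" for k
      using arc_type_in_set_partitions[of "restrict_order \<phi> (Js ! k)" "snd (xs ! k)"] ok[OF that] \<phi>
      by (simp add: nus_def)
    have nu: "nu \<in> set_partitions \<phi>" "splits Js nu"
      "\<And>k. k < length Js \<Longrightarrow> arcs_on nu (Js ! k) = nus k"
      using set_partitions_Union[of nus \<phi>] nus unfolding nu_def by blast+
    have xs_nu: "(\<Union>x\<in>set xs. arc_type (fst x) (snd x)) = nu"
      unfolding nu_def nus_def set_conv_nth len by auto
    \<comment> \<open>If \<open>mu\<close> is not contained in \<open>nu\<close>, then
      \<open>arcs_on_subset_splits\<close> finds a block where the inclusion fails, and the factor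
      of that block vanishes.\<close>
    have P': "?P mu = (if mu \<subseteq> nu then \<Prod>k<length Js. 1 / of_nat q ^ nst \<phi> (arcs_on mu (Js ! k))
         (arcs_on nu (Js ! k) - arcs_on mu (Js ! k)) else 0)" if mu: "splits Js mu" for mu
    proof (cases "mu \<subseteq> nu")
      case True
      have "P_elem q (restrict_order \<phi> (Js ! k)) (arcs_on mu (Js ! k)) (xs ! k) =
        1 / of_nat q ^ nst \<phi> (arcs_on mu (Js ! k)) (arcs_on nu (Js ! k) - arcs_on mu (Js ! k))"
        if k: "k < length Js" for k
      proof -
        have "arcs_on mu (Js ! k) \<subseteq> arcs_on nu (Js ! k)" using True by (auto simp: arcs_on_def)
        moreover have "nst (restrict_order \<phi> (Js ! k)) (arcs_on mu (Js ! k))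
            (arcs_on nu (Js ! k) - arcs_on mu (Js ! k)) =
          nst \<phi> (arcs_on mu (Js ! k)) (arcs_on nu (Js ! k) - arcs_on mu (Js ! k))"
          by (rule nst_restrict_order) (auto simp: arcs_on_def)
        ultimately show ?thesis
          using ok[OF k] nu(3)[OF k] \<phi> by (simp add: P_elem_eq nus_def)
      qed
      then show ?thesis using True len unfolding P by simp
    next
      case False
      then obtain k where "k < length Js" "\<not> arcs_on mu (Js ! k) \<subseteq> arcs_on nu (Js ! k)"
        using arcs_on_subset_splits[OF mu] by blast
      then have "P_elem q (restrict_order \<phi> (Js ! k)) (arcs_on mu (Js ! k)) (xs ! k) = 0"
        using ok[of k] nu(3)[of k] \<phi> by (simp add: P_elem_eq nus_def)
      then show ?thesis using False \<open>k < length Js\<close> unfolding P by (auto intro!: prod_zero)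
    qed
    \<comment> \<open>Subsets of \<open>nu\<close> inherit both properties from \<open>nu\<close>,
      so every \<open>mu\<close> between \<open>lam\<close> and \<open>nu\<close> occurs in the
      sum.\<close>
    have sub: "{mu. lam \<subseteq> mu \<and> mu \<subseteq> nu} \<subseteq> ?S"
      using set_partitions_mono[OF nu(1)] splits_mono[OF nu(2)] by blast
    have "(\<Sum>mu\<in>?S. coeff_a q \<phi> Js lam mu * ?P mu) =
      (\<Sum>mu | lam \<subseteq> mu \<and> mu \<subseteq> nu. coeff_a q \<phi> Js lam mu * ?P mu)"
      using sub by (intro sum.mono_neutral_right) (auto simp: P')
    also have "\<dots> = (\<Sum>mu | lam \<subseteq> mu \<and> mu \<subseteq> nu. coeff_a q \<phi> Js lam mu *
      (\<Prod>k<length Js. 1 / of_nat q ^ nst \<phi> (arcs_on mu (Js ! k))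
         (arcs_on nu (Js ! k) - arcs_on mu (Js ! k))))"
      using splits_mono[OF nu(2)] by (intro sum.cong refl) (auto simp: P')
    also have "\<dots> = ?g nu"
    proof (cases "lam \<subseteq> nu")
      case True
      then show ?thesis
        using sum_coeff_a[OF \<phi> finite_set_partition[OF nu(1)] nu(2)] by simp
    next
      case False
      then have "{mu. lam \<subseteq> mu \<and> mu \<subseteq> nu} = {}" by blast
      then show ?thesis using False by (simp only: sum.empty if_False)
    qed
    also have "\<dots> = class_tensor \<phi> Js ?g xs" using True by (simp add: class_tensor_def xs_nu)
    finally show ?thesis .
  qed
qed

end

text \<open>By \<open>tensor_P_elem\<close> the function is a \<open>class_tensor\<close> with one
  factor, and the iterated coproduct only refines the blocks.\<close>

lemma coprod_comp_P_elem:
  assumes \<phi>: "distinct \<phi>" and Js: "\<Union> (set Js) = set \<phi>"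
    and disj: "\<And>a b. a < length Js \<Longrightarrow> b < length Js \<Longrightarrow> a \<noteq> b \<Longrightarrow> Js ! a \<inter> Js ! b = {}"
  shows "coprod_comp Js (P_elem q \<phi> lam :: ('a, 'f::field) func) = class_tensor \<phi> Js
    (\<lambda>nu. if lam \<subseteq> nu then 1 / of_nat q ^ nst \<phi> lam (nu - lam) else 0)"
proof (cases Js)
  \<comment> \<open>Here the counit evaluates at the identity of the trivial group, whose arc type
    is empty.\<close>
  case Nil
  then have [simp]: "\<phi> = []" using Js by simp
  have one: "one_matr {} \<in> (U [] :: ('a, 'f) matr set)"
    using triangular_one[of "[]"] by (simp add: U_iff)
  have "arc_type [] (one_matr {} :: ('a, 'f) matr) = {}"
    using set_partitions_subset[OF arc_type_in_set_partitions[OF _ one]] by simp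
  then show ?thesis
    using one by (auto simp: Nil fun_eq_iff class_tensor_def P_elem_eq)
next
  case (Cons J Js')
  have "sorted_wrt (\<lambda>A B. A \<inter> B = {}) Js"
    using disj by (auto simp: sorted_wrt_iff_nth_less)
  moreover have full: "\<Union> (set (J # Js')) = set \<phi>" using Js Cons by simp
  ultimately have "iter_coprod J Js' (class_tensor \<phi> [set \<phi>] g :: ('a, 'f) tens) =
    class_tensor \<phi> (J # Js') g" for g
    unfolding full[symmetric] using Cons full by (intro iter_coprod_class_tensor[OF \<phi>]) auto
  then show ?thesis by (simp add: Cons tensor_P_elem[OF \<phi>])
qed

theorem theorem4p5:
  fixes q :: nat
    and K :: "'a set"
    and \<phi> :: "'a list"
    and lam :: "('a \<times> 'a) set"
    and Js :: "'a set list"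
  assumes "q = CARD('f::{field,finite})"
    and "finite K"
    and "\<phi> \<in> permutations_of_set K"
    and "lam \<in> set_partitions \<phi>"
    and "set_composition Js K"
  shows "(lam \<noteq> (\<Union>J\<in>set Js. arcs_on lam J) \<longrightarrow>
            coprod_comp Js (P_elem q \<phi> lam :: ('a, 'f) func) = (\<lambda>_. 0)) \<and>
         (lam = (\<Union>J\<in>set Js. arcs_on lam J) \<longrightarrow>
            coprod_comp Js (P_elem q \<phi> lam :: ('a, 'f) func) =
              (\<lambda>xs. \<Sum>mu | mu \<in> set_partitions \<phi> \<and> lam \<subseteq> mu \<and>
                             mu = (\<Union>J\<in>set Js. arcs_on mu J).
                 coeff_a q \<phi> Js lam mu *
                 tensor (map (\<lambda>J. P_elem q (restrict_order \<phi> J) (arcs_on mu J)) Js) xs))"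
proof -
  have \<phi>: "distinct \<phi>" "set \<phi> = K"
    using assms(3) by (auto simp: permutations_of_set_def)
  have Js: "\<Union> (set Js) = set \<phi>"
    and disj: "\<And>a b. a < length Js \<Longrightarrow> b < length Js \<Longrightarrow> a \<noteq> b \<Longrightarrow> Js ! a \<inter> Js ! b = {}"
    using assms(5) \<phi>(2) by (auto simp: set_composition_def)
  let ?rhs = "(\<lambda>xs. \<Sum>mu | mu \<in> set_partitions \<phi> \<and> lam \<subseteq> mu \<and> splits Js mu.
       coeff_a q \<phi> Js lam mu *
       tensor (map (\<lambda>J. P_elem q (restrict_order \<phi> J) (arcs_on mu J)) Js) xs) :: ('a, 'f) tens"
  have eq: "coprod_comp Js (P_elem q \<phi> lam :: ('a, 'f) func) = ?rhs"
    by (rule trans[OF coprod_comp_P_elem[OF \<phi>(1) Js disj]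
          sum_tensor_P_elem[OF disj \<phi>(1) Js, symmetric]])
  \<comment> \<open>One formula covers both cases: if \<open>lam\<close> has an arc between blocks,
    so does every superset, and the sum is empty.\<close>
  have "?rhs = (\<lambda>_. 0)" if "\<not> splits Js lam"
  proof -
    have "{mu. mu \<in> set_partitions \<phi> \<and> lam \<subseteq> mu \<and> splits Js mu} = {}"
      using that splits_mono by blast
    then show ?thesis by (simp only: sum.empty)
  qed
  then show ?thesis
    using eq unfolding splits_def[symmetric] by simp
qed

end
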